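(* There exist exactly $144$ simple objects in the category ${}_{\mathcal{D}}\mathcal{M}$ of left $\mathcal{D}$-modules up to isomorphism, where $\mathcal{D}=\mathcal{D}(\mathcal{K}_{24,1}^{cop})$ is the Drinfeld double of $\mathcal{K}_{24,1}^{cop}$. Among them are the $24$ one-dimensional objects $\mathbf{k}_{\chi_{i,j,k}}$ with $(i,j,k)\in\{0,1\}\times\{0,1\}\times\{0,\dots,5\}$ and the $120$ two-dimensional simple objects $V_{i,j,k,\iota}$ with $(i,j,k,\iota)\in\Lambda$.
   Context: $\mathbf{k}$ is an algebraically closed field of characteristic zero, $\xi\in\mathbf{k}$ a primitive $6$th root of unity, and $\sqrt{1-\xi^2}$ a fixed square root. The Hopf algebra $\mathcal{K}_{24,1}$ is generated as an algebra by $a,b,c,d$ subject to $a^6=1$, $b^2=0$, $c^2=0$, $d^6=1$, $a^2=d^2$, $ad=da$, $bc=0=cb$, $ab=\xi ba$, $ac=\xi ca$, $db=-\xi bd$, $dc=-\xi cd$, $bd=ca$, $ba=cd$; with $\Delta(a)=a\otimes a+b\otimes c$, $\Delta(b)=a\otimes b+b\otimes d$, $\Delta(c)=c\otimes a+d\otimes c$, $\Delta(d)=d\otimes d+c\otimes b$, $\epsilon(a)=\epsilon(d)=1$, $\epsilon(b)=\epsilon(c)=0$. The Drinfeld double $\mathcal{D}=\mathcal{D}(\mathcal{K}_{24,1}^{cop})$ is described by the following presentation: it is the algebra generated by $g,h,x,a,b,c,d$ subject to the relations $a^6=1$, $b^2=0$, $c^2=0$, $d^6=1$, $a^2=d^2$,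 $ad=da$, $bc=0=cb$, $ab=\xi ba$, $ac=\xi ca$, $db=-\xi bd$, $dc=-\xi cd$, $bd=ca$, $ba=cd$, the relations $g^6=1$, $h^2=1$, $gh=hg$, $gx=xg$, $hx=-xh$, $x^2=1-g^2$, and $ag=ga$, $ah=ha$, $dg=gd$, $dh=hd$, $bg=gb$, $bh=-hb$, $cg=gc$, $ch=-hc$, $ax-\xi^{-1}xa=-\sqrt{1-\xi^2}\,\xi^{-1}(c-ghb)$, $dx+\xi^{-1}xd=-\sqrt{1-\xi^2}\,\xi^{-1}(ghc-b)$, $bx-\xi^{-1}xb=-\sqrt{1-\xi^2}\,\xi^{-1}(d-gha)$, $cx+\xi^{-1}xc=-\sqrt{1-\xi^2}\,\xi^{-1}(ghd-a)$. $\mathbf{k}_{\chi_{i,j,k}}$ is the one-dimensional module with character $\chi_{i,j,k}$: $g\mapsto(-1)^i$, $h\mapsto(-1)^j$, $x\mapsto0$, $a\mapsto\xi^k$, $b\mapsto0$, $c\mapsto0$, $d\mapsto(-1)^i(-1)^j\xi^k$. $\Lambda=\{(i,j,k,\iota)\mid i,j\in\{0,\dots,5\},\ k,\iota\in\{0,1\},\ j+3k\not\equiv3(\iota+1)\bmod6\}$ (so $|\Lambda|=120$). $V_{i,j,k,\iota}$ has basis $v_1,v_2$ and action (matrices act on column vectors in this basis): $a v_1=(-1)^{\iota+1}\xi^iv_1$, $av_2=(-1)^{\iota+1}\xi^{i-1}v_2$, $dv_1=\xi^iv_1$, $dv_2=-\xi^{i-1}v_2$, $bv_1=0$, $bv_2=(-1)^\iota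 v_1$, $cv_1=0$, $cv_2=v_1$, $gv_1=\xi^jv_1$, $gv_2=\xi^jv_2$, $hv_1=(-1)^kv_1$, $hv_2=(-1)^{k+1}v_2$, $xv_1=-\sqrt{1-\xi^2}\,\xi^{i-1}(\xi^j(-1)^k+(-1)^\iota)v_2$, $xv_2=(1-\xi^2)^{-1/2}\xi^{1-i}(\xi^j(-1)^k-(-1)^\iota)v_1$. *)

theory Defs
  imports
    "HOL-Analysis.Analysis"
    "HOL-Algebra.Algebraic_Closure_Type"
    "HOL-Library.Poly_Mapping"
    "HOL-Number_Theory.Cong"
begin

section \<open>Free algebras and algebras given by generators and relations\<close>

text \<open>
  The free monoid on \<open>'g\<close>, written additively: the convolution product of
  \<^theory>\<open>HOL-Library.Poly_Mapping\<close> then turns the finitely supported functions on it into the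
  free algebra, and multiplication of monomials is concatenation of words.
\<close>

datatype 'g fmonoid = Letters (letters: "'g list")

instantiation fmonoid :: (type) monoid_add
begin

definition zero_fmonoid :: "'a fmonoid" where
  "0 = Letters []"

definition plus_fmonoid :: "'a fmonoid \<Rightarrow> 'a fmonoid \<Rightarrow> 'a fmonoid" where
  "u + v = Letters (letters u @ letters v)"

instance
  by standard (simp_all add: zero_fmonoid_def plus_fmonoid_def)

end

type_synonym ('g, 'k) free_algebra = "'g fmonoid \<Rightarrow>\<^sub>0 'k"

definition fgen :: "'g \<Rightarrow> ('g, 'k::field) free_algebra" where
  "fgen y = Poly_Mapping.single (Letters [y]) 1"

definition fconst :: "'k::field \<Rightarrow> ('g, 'k) free_algebra" where
  "fconst c = Poly_Mapping.single 0 c"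

text \<open>A pair \<open>(l, r)\<close> in \<open>Rel\<close> stands for the relation \<open>l = r\<close>; \<open>Idl\<close> is the two-sided ideal.\<close>

definition presented_algebra ::
  "(('g, 'k::field) free_algebra \<times> ('g, 'k) free_algebra) set \<Rightarrow> ('g, 'k) free_algebra set ring"
  where
  "presented_algebra Rel =
     ring_of_type_algebra Quot (Idl\<^bsub>ring_of_type_algebra\<^esub> {l - r |l r. (l, r) \<in> Rel})"


section \<open>Left modules over noncommutative rings\<close>

text \<open>
  The library locale for modules requires a commutative base ring. The fields \<open>mult\<close> and \<open>one\<close>
  of the module record play no role.
\<close>

definition left_module :: "('a, 'r) ring_scheme \<Rightarrow> ('a, 'm, 'e) module_scheme \<Rightarrow> bool" where
  "left_module R M \<longleftrightarrow> ring R \<and> abelian_group M \<and>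
     (\<forall>r\<in>carrier R. \<forall>x\<in>carrier M. r \<odot>\<^bsub>M\<^esub> x \<in> carrier M) \<and>
     (\<forall>r\<in>carrier R. \<forall>r'\<in>carrier R. \<forall>x\<in>carrier M.
        (r \<oplus>\<^bsub>R\<^esub> r') \<odot>\<^bsub>M\<^esub> x = (r \<odot>\<^bsub>M\<^esub> x) \<oplus>\<^bsub>M\<^esub> (r' \<odot>\<^bsub>M\<^esub> x)) \<and>
     (\<forall>r\<in>carrier R. \<forall>x\<in>carrier M. \<forall>y\<in>carrier M.
        r \<odot>\<^bsub>M\<^esub> (x \<oplus>\<^bsub>M\<^esub> y) = (r \<odot>\<^bsub>M\<^esub> x) \<oplus>\<^bsub>M\<^esub> (r \<odot>\<^bsub>M\<^esub> y)) \<and>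
     (\<forall>r\<in>carrier R. \<forall>r'\<in>carrier R. \<forall>x\<in>carrier M.
        (r \<otimes>\<^bsub>R\<^esub> r') \<odot>\<^bsub>M\<^esub> x = r \<odot>\<^bsub>M\<^esub> (r' \<odot>\<^bsub>M\<^esub> x)) \<and>
     (\<forall>x\<in>carrier M. \<one>\<^bsub>R\<^esub> \<odot>\<^bsub>M\<^esub> x = x)"

definition simple_left_module :: "('a, 'r) ring_scheme \<Rightarrow> ('a, 'm) module \<Rightarrow> bool" where
  "simple_left_module R M \<longleftrightarrow> left_module R M \<and> carrier M \<noteq> {\<zero>\<^bsub>M\<^esub>} \<and>
     (\<forall>N. submodule N R M \<longrightarrow> N = {\<zero>\<^bsub>M\<^esub>} \<or> N = carrier M)"

definition module_iso ::
  "('a, 'r) ring_scheme \<Rightarrow> ('a, 'm) module \<Rightarrow> ('a, 'n) module \<Rightarrow> bool" where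
  "module_iso R M N \<longleftrightarrow> (\<exists>f. bij_betw f (carrier M) (carrier N) \<and>
     (\<forall>x\<in>carrier M. \<forall>y\<in>carrier M. f (x \<oplus>\<^bsub>M\<^esub> y) = f x \<oplus>\<^bsub>N\<^esub> f y) \<and>
     (\<forall>r\<in>carrier R. \<forall>x\<in>carrier M. f (r \<odot>\<^bsub>M\<^esub> x) = r \<odot>\<^bsub>N\<^esub> f x))"

text \<open>Isomorphism classes of the simple modules whose carrier is a subset of the type \<open>'m\<close>.\<close>

definition simple_classes :: "('a, 'r) ring_scheme \<Rightarrow> ('a, 'm) module set set" where
  "simple_classes R =
     {M. simple_left_module R M} //
     {(M, N). simple_left_module R M \<and> simple_left_module R N \<and> module_iso R M N}"

text \<open>
  The module on the column space \<open>k\<^sup>n\<close> over an algebra presented on the generators \<open>'g\<close>, in which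
  the generator \<open>y\<close> acts as the matrix \<open>\<rho> y\<close> and constants act as scalars. An element of the
  presented algebra is a coset, and acts through an arbitrary representative; if the matrices
  satisfy the defining relations, the choice does not matter.
\<close>

definition free_action ::
  "('g \<Rightarrow> 'k::field^'n^'n) \<Rightarrow> ('g, 'k) free_algebra \<Rightarrow> 'k^'n \<Rightarrow> 'k^'n" where
  "free_action \<rho> p v =
     (\<Sum>w\<in>Poly_Mapping.keys p. Poly_Mapping.lookup p w *s foldr (\<lambda>y u. \<rho> y *v u) (letters w) v)"

definition matrix_module ::
  "('g \<Rightarrow> 'k::field^'n^'n) \<Rightarrow> (('g, 'k) free_algebra set, 'k^'n) module" where
  "matrix_module \<rho> =
     \<lparr>carrier = UNIV, mult = undefined, one = undefined, zero = 0, add = (+),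
      smult = (\<lambda>P. free_action \<rho> (SOME p. p \<in> P))\<rparr>"


section \<open>The Drinfeld double of $\mathcal{K}_{24,1}^{cop}$\<close>

definition primitive_root_of_unity :: "nat \<Rightarrow> 'k::field \<Rightarrow> bool" where
  "primitive_root_of_unity n z \<longleftrightarrow> 0 < n \<and> z ^ n = 1 \<and> (\<forall>m. 0 < m \<and> m < n \<longrightarrow> z ^ m \<noteq> 1)"

datatype dgen = Gen_g | Gen_h | Gen_x | Gen_a | Gen_b | Gen_c | Gen_d

text \<open>Here and below, \<open>s\<close> is the chosen square root of \<open>1 - \<xi>\<^sup>2\<close>.\<close>

definition K24_relations ::
  "'k::field \<Rightarrow> ((dgen, 'k) free_algebra \<times> (dgen, 'k) free_algebra) set" where
  "K24_relations \<xi> =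
    (let a = fgen Gen_a; b = fgen Gen_b; c = fgen Gen_c; d = fgen Gen_d; q = fconst \<xi> in
     {(a ^ 6, 1), (b ^ 2, 0), (c ^ 2, 0), (d ^ 6, 1), (a ^ 2, d ^ 2), (a * d, d * a),
      (b * c, 0), (c * b, 0),
      (a * b, q * b * a), (a * c, q * c * a), (d * b, - q * b * d), (d * c, - q * c * d),
      (b * d, c * a), (b * a, c * d)})"

definition double_relations ::
  "'k::field \<Rightarrow> 'k \<Rightarrow> ((dgen, 'k) free_algebra \<times> (dgen, 'k) free_algebra) set" where
  "double_relations \<xi> s = K24_relations \<xi> \<union>
    (let g = fgen Gen_g; h = fgen Gen_h; x = fgen Gen_x;
         a = fgen Gen_a; b = fgen Gen_b; c = fgen Gen_c; d = fgen Gen_d;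
         q' = fconst (inverse \<xi>); t = fconst (- s * inverse \<xi>) in
     {(g ^ 6, 1), (h ^ 2, 1), (g * h, h * g), (g * x, x * g), (h * x, - x * h),
      (x ^ 2, 1 - g ^ 2),
      (a * g, g * a), (a * h, h * a), (d * g, g * d), (d * h, h * d),
      (b * g, g * b), (b * h, - h * b), (c * g, g * c), (c * h, - h * c),
      (a * x - q' * x * a, t * (c - g * h * b)),
      (d * x + q' * x * d, t * (g * h * c - b)),
      (b * x - q' * x * b, t * (d - g * h * a)),
      (c * x + q' * x * c, t * (g * h * d - a))})"

type_synonym 'k double_elem = "(dgen, 'k) free_algebra set"

definition double :: "'k::field \<Rightarrow> 'k \<Rightarrow> 'k double_elem ring" where
  "double \<xi> s = presented_algebra (double_relations \<xi> s)"


section \<open>The modules $\mathbf{k}_{\chi_{i,j,k}}$ and $V_{i,j,k,\iota}$\<close>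

definition chi_index :: "(nat \<times> nat \<times> nat) set" where
  "chi_index = {0, 1} \<times> {0, 1} \<times> {0..5}"

fun chi :: "'k::field \<Rightarrow> nat \<Rightarrow> nat \<Rightarrow> nat \<Rightarrow> dgen \<Rightarrow> 'k" where
  "chi \<xi> i j k Gen_g = (- 1) ^ i"
| "chi \<xi> i j k Gen_h = (- 1) ^ j"
| "chi \<xi> i j k Gen_x = 0"
| "chi \<xi> i j k Gen_a = \<xi> ^ k"
| "chi \<xi> i j k Gen_b = 0"
| "chi \<xi> i j k Gen_c = 0"
| "chi \<xi> i j k Gen_d = (- 1) ^ i * (- 1) ^ j * \<xi> ^ k"

definition k_chi :: "'k::field \<Rightarrow> nat \<Rightarrow> nat \<Rightarrow> nat \<Rightarrow> ('k double_elem, 'k^1) module" where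
  "k_chi \<xi> i j k = matrix_module (\<lambda>y. mat (chi \<xi> i j k y))"

definition Lambda :: "(nat \<times> nat \<times> nat \<times> nat) set" where
  "Lambda = {(i, j, k, \<iota>). i \<in> {0..5} \<and> j \<in> {0..5} \<and> k \<in> {0, 1} \<and> \<iota> \<in> {0, 1} \<and>
     \<not> [j + 3 * k = 3 * (\<iota> + 1)] (mod 6)}"

text \<open>Matrices are written by rows, so the image of \<open>v\<^sub>m\<close> is the \<open>m\<close>-th column.\<close>

definition mat22 :: "'k::field \<Rightarrow> 'k \<Rightarrow> 'k \<Rightarrow> 'k \<Rightarrow> 'k^2^2" where
  "mat22 p q r t = vector [vector [p, q], vector [r, t]]"

fun V_matrix :: "'k::field \<Rightarrow> 'k \<Rightarrow> nat \<Rightarrow> nat \<Rightarrow> nat \<Rightarrow> nat \<Rightarrow> dgen \<Rightarrow> 'k^2^2" where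
  "V_matrix \<xi> s i j k \<iota> Gen_a =
     mat22 ((- 1) ^ (\<iota> + 1) * \<xi> ^ i) 0
           0 ((- 1) ^ (\<iota> + 1) * \<xi> powi (int i - 1))"
| "V_matrix \<xi> s i j k \<iota> Gen_d =
     mat22 (\<xi> ^ i) 0
           0 (- (\<xi> powi (int i - 1)))"
| "V_matrix \<xi> s i j k \<iota> Gen_b =
     mat22 0 ((- 1) ^ \<iota>)
           0 0"
| "V_matrix \<xi> s i j k \<iota> Gen_c =
     mat22 0 1
           0 0"
| "V_matrix \<xi> s i j k \<iota> Gen_g =
     mat22 (\<xi> ^ j) 0
           0 (\<xi> ^ j)"
| "V_matrix \<xi> s i j k \<iota> Gen_h =
     mat22 ((- 1) ^ k) 0
           0 ((- 1) ^ (k + 1))"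
| "V_matrix \<xi> s i j k \<iota> Gen_x =
     mat22 0 (inverse s * \<xi> powi (1 - int i) * (\<xi> ^ j * (- 1) ^ k - (- 1) ^ \<iota>))
           (- s * \<xi> powi (int i - 1) * (\<xi> ^ j * (- 1) ^ k + (- 1) ^ \<iota>)) 0"

definition V_module ::
  "'k::field \<Rightarrow> 'k \<Rightarrow> nat \<Rightarrow> nat \<Rightarrow> nat \<Rightarrow> nat \<Rightarrow> ('k double_elem, 'k^2) module" where
  "V_module \<xi> s i j k \<iota> = matrix_module (V_matrix \<xi> s i j k \<iota>)"

end

theory Submission
  imports Defs
begin

text \<open>
  Let \<open>M\<close> be a simple module over the double. All products of two of the letters \<open>b\<close>, \<open>c\<close> are
  zero, so some nonzero vector is killed by both. Their common kernel is stable under \<open>g\<close>, \<open>h\<close>,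
  \<open>a\<close>, \<open>d\<close>, which commute with each other and have finite order dividing 6; averaging over the
  powers of each of them with weights taken from the roots of unity yields a common eigenvector
  \<open>v\<close> in this kernel (\<open>weight_vector_exists\<close>).

  The relations that move \<open>x\<close> past the other generators show that \<open>x v\<close> is again an eigenvector
  of \<open>g\<close>, \<open>h\<close>, \<open>a\<close>, \<open>d\<close>, while \<open>b x v\<close>, \<open>c x v\<close> and \<open>x x v\<close> are multiples of \<open>v\<close>
  (\<open>x_weight_vector\<close>). So \<open>v\<close> and \<open>x v\<close> span a submodule, and everything depends on the scalar
  \<open>\<kappa>\<close> with \<open>c x v = \<kappa> v\<close>. If \<open>\<kappa>\<close> is not zero, then \<open>v\<close> and \<open>x v / \<kappa>\<close> behave like the
  standard basis of one of the modules \<open>V\<close> (\<open>iso_V_module\<close>). If \<open>\<kappa>\<close> is zero, then \<open>x v\<close> is killed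
  by \<open>b\<close>, \<open>c\<close> and \<open>x\<close>, so \<open>x v\<close>, or \<open>v\<close> itself in case \<open>x v = 0\<close>, spans a one-dimensional
  submodule (\<open>iso_k_chi\<close>). In both cases this gives a nonzero homomorphism from a listed module
  to \<open>M\<close>, and the lemma of Schur turns it into an isomorphism.

  The index set \<open>\<Lambda>\<close> consists of the parameters with \<open>\<kappa> \<noteq> 0\<close> (\<open>kappa_nonzero_iff\<close>), which is
  also what makes \<open>V\<close> simple. The parameters can be read off from a module: they are eigenvalues
  of generators on the kernel of \<open>c\<close>. For the number of isomorphism classes, each listed module
  is carried over to a subset of the given type along an injection of the plane into that type
  (\<open>transport_left_module\<close>, \<open>card_simple_classes\<close>).

  Modules over a presented algebra are handled through the action of the free algebra: the
  elements of the presented algebra are cosets, and every computation is done with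
  representatives.
\<close>

section \<open>Rings as types and rings as records\<close>

lemma ring_of_type_algebra_sel [simp]:
  "carrier ring_of_type_algebra = UNIV"
  "mult ring_of_type_algebra = (*)" "one ring_of_type_algebra = 1"
  "zero ring_of_type_algebra = 0" "add ring_of_type_algebra = (+)"
  by (simp_all add: ring_of_type_algebra_def fun_eq_iff)

lemma ring_ring_of_type_algebra: "ring (ring_of_type_algebra :: 'a::ring_1 ring)"
proof (rule ringI)
  show "abelian_group (ring_of_type_algebra :: 'a ring)"
  proof (rule abelian_groupI)
    fix p :: 'a
    show "\<exists>q\<in>carrier ring_of_type_algebra. q \<oplus>\<^bsub>ring_of_type_algebra\<^esub> p = \<zero>\<^bsub>ring_of_type_algebra\<^esub>"
      by (simp add: exI[of _ "- p"])
  qed (simp_all add: add_ac)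
  show "monoid (ring_of_type_algebra :: 'a ring)"
    by (rule monoidI) (simp_all add: mult.assoc)
qed (simp_all add: distrib_left distrib_right)

text \<open>
  Ideals of the type-level ring in terms of its own operations, free of the record syntax.
\<close>

lemma ideal_ring_of_type_algebraI:
  fixes I :: "'a::ring_1 set"
  assumes "0 \<in> I" "\<And>p q. p \<in> I \<Longrightarrow> q \<in> I \<Longrightarrow> p - q \<in> I"
    "\<And>p q. p \<in> I \<Longrightarrow> q * p \<in> I" "\<And>p q. p \<in> I \<Longrightarrow> p * q \<in> I"
  shows "ideal I ring_of_type_algebra"
proof -
  interpret F: ring "ring_of_type_algebra :: 'a ring" by (rule ring_ring_of_type_algebra)
  have neg: "- p \<in> I" if "p \<in> I" for p
    using assms(2)[OF assms(1) that] by simp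
  have add: "p + q \<in> I" if "p \<in> I" "q \<in> I" for p q
    using assms(2)[OF that(1) neg[OF that(2)]] by simp
  have minv: "\<ominus>\<^bsub>ring_of_type_algebra\<^esub> p = - p" for p :: 'a
    using F.minus_equality[of "- p" p] by simp
  have "subgroup I (add_monoid ring_of_type_algebra)"
    by (rule subgroup.intro, unfold a_inv_def[symmetric] minv) (auto intro: assms add neg)
  then show ?thesis
    by (rule idealI[OF ring_ring_of_type_algebra]) (use assms in auto)
qed

section \<open>Algebras presented by generators and relations\<close>

type_synonym ('g, 'k) relations = "(('g, 'k) free_algebra \<times> ('g, 'k) free_algebra) set"

definition relation_ideal :: "('g, 'k::field) relations \<Rightarrow> ('g, 'k) free_algebra set" where
  "relation_ideal Rel = Idl\<^bsub>ring_of_type_algebra\<^esub> {l - r |l r. (l, r) \<in> Rel}"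

definition residue_class ::
  "('g, 'k::field) relations \<Rightarrow> ('g, 'k) free_algebra \<Rightarrow> ('g, 'k) free_algebra set" where
  "residue_class Rel p = relation_ideal Rel +>\<^bsub>ring_of_type_algebra\<^esub> p"

lemma ideal_relation_ideal: "ideal (relation_ideal Rel) ring_of_type_algebra"
  unfolding relation_ideal_def
  by (rule ring.genideal_ideal[OF ring_ring_of_type_algebra]) simp

lemma relation_ideal_minimal:
  assumes "ideal I ring_of_type_algebra" "\<And>l r. (l, r) \<in> Rel \<Longrightarrow> l - r \<in> I"
  shows "relation_ideal Rel \<subseteq> I"
  unfolding relation_ideal_def
  by (rule ring.genideal_minimal[OF ring_ring_of_type_algebra assms(1)]) (use assms(2) in auto)

lemma presented_algebra_eq: "presented_algebra Rel = ring_of_type_algebra Quot relation_ideal Rel"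
  by (simp add: presented_algebra_def relation_ideal_def)

lemma ring_presented_algebra: "ring (presented_algebra Rel)"
  unfolding presented_algebra_eq by (rule ideal.quotient_is_ring[OF ideal_relation_ideal])

lemma residue_class_hom: "residue_class Rel \<in> ring_hom ring_of_type_algebra (presented_algebra Rel)"
  using ideal.rcos_ring_hom[OF ideal_relation_ideal, of Rel]
  by (simp add: presented_algebra_eq residue_class_def[abs_def])

lemma residue_class_simps:
  "residue_class Rel p \<in> carrier (presented_algebra Rel)"
  "residue_class Rel (p + q) = residue_class Rel p \<oplus>\<^bsub>presented_algebra Rel\<^esub> residue_class Rel q"
  "residue_class Rel (p * q) = residue_class Rel p \<otimes>\<^bsub>presented_algebra Rel\<^esub> residue_class Rel q"
  "residue_class Rel 1 = \<one>\<^bsub>presented_algebra Rel\<^esub>"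
  using ring_hom_closed[OF residue_class_hom, of p Rel] ring_hom_add[OF residue_class_hom, of p q Rel]
    ring_hom_mult[OF residue_class_hom, of p q Rel] ring_hom_one[OF residue_class_hom, of Rel]
  by simp_all

lemma residue_class_altdef: "residue_class Rel p = {u + p |u. u \<in> relation_ideal Rel}"
  by (auto simp: residue_class_def a_r_coset_def r_coset_def)

lemma residue_class_cases:
  assumes "P \<in> carrier (presented_algebra Rel)"
  obtains p where "P = residue_class Rel p"
  using assms unfolding presented_algebra_eq
  unfolding FactRing_def A_RCOSETS_def RCOSETS_def a_r_coset_def[symmetric] partial_object.simps
    residue_class_def UN_iff singleton_iff by blast

lemma residue_class_ball:
  "(\<forall>P\<in>carrier (presented_algebra Rel). Q P) \<longleftrightarrow> (\<forall>p. Q (residue_class Rel p))"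
  by (metis residue_class_cases residue_class_simps(1))

lemma residue_class_relation:
  assumes "(l, r) \<in> Rel"
  shows "residue_class Rel l = residue_class Rel r"
proof -
  interpret I: ideal "relation_ideal Rel" "ring_of_type_algebra"
    by (rule ideal_relation_ideal)
  have "l - r \<in> relation_ideal Rel"
    unfolding relation_ideal_def
    using ring.genideal_self[OF ring_ring_of_type_algebra, of "{l - r |l r. (l, r) \<in> Rel}"] assms
    by auto
  then have "l \<in> relation_ideal Rel +>\<^bsub>ring_of_type_algebra\<^esub> r"
    by (auto simp: a_r_coset_def r_coset_def intro!: bexI[of _ "l - r"])
  from I.a_repr_independence[OF this] show ?thesis
    using I.a_subgroup by (simp add: residue_class_def)
qed

text \<open>
  The action on a matrix module is defined through an arbitrarily chosen representative of a
  coset; this controls the choice.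
\<close>

lemma some_in_residue_class:
  "(SOME p'. p' \<in> residue_class Rel p) - p \<in> relation_ideal Rel"
proof -
  have "0 \<in> relation_ideal Rel"
    using additive_subgroup.zero_closed[OF ideal.axioms(1)[OF ideal_relation_ideal[of Rel]]] by simp
  then have "p \<in> residue_class Rel p"
    by (auto simp: residue_class_altdef intro!: exI[of _ 0])
  then have "(SOME p'. p' \<in> residue_class Rel p) \<in> residue_class Rel p"
    by (rule someI)
  then show ?thesis by (auto simp: residue_class_altdef)
qed

section \<open>The free algebra and its action on columns\<close>

text \<open>
  A finitely supported function is the sum of its monomials.
\<close>

lemma free_algebra_add_induct:
  assumes "\<And>w c. P (Poly_Mapping.single w c)" "\<And>p q. P p \<Longrightarrow> P q \<Longrightarrow> P (p + q)"
  shows "P (p :: 'a \<Rightarrow>\<^sub>0 'b::comm_monoid_add)"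
proof -
  have "P 0" using assms(1)[of undefined 0] by simp
  have "P (\<Sum>w\<in>A. Poly_Mapping.single w (Poly_Mapping.lookup p w))" if "finite A" for A
    using that \<open>P 0\<close> by (induction A rule: finite_induct) (use assms in auto)
  moreover have "p = (\<Sum>w\<in>Poly_Mapping.keys p. Poly_Mapping.single w (Poly_Mapping.lookup p w))"
    by (rule poly_mapping_eqI)
       (auto simp: lookup_sum lookup_single when_def sum.delta' in_keys_iff)
  ultimately show ?thesis by (metis finite_keys)
qed

lemma free_algebra_induct [case_names const gen add mult]:
  assumes const: "\<And>c. P (fconst c)" and gen: "\<And>y. P (fgen y)"
    and add: "\<And>p q. P p \<Longrightarrow> P q \<Longrightarrow> P (p + q)" and mult: "\<And>p q. P p \<Longrightarrow> P q \<Longrightarrow> P (p * q)"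
  shows "P p"
proof (rule free_algebra_add_induct)
  fix w c
  have "P (Poly_Mapping.single (Letters u) c)" for u
  proof (induction u)
    case Nil
    show ?case using const[of c] by (simp add: fconst_def zero_fmonoid_def)
  next
    case (Cons y u)
    then show ?case
      using mult[OF gen[of y] Cons] by (simp add: fgen_def mult_single plus_fmonoid_def)
  qed
  then show "P (Poly_Mapping.single w c)" by (cases w) auto
qed (rule add)

lemma fconst_simps:
  "fconst (c + d) = fconst c + fconst d" "fconst (c * d) = fconst c * fconst d"
  "fconst 0 = 0" "fconst 1 = 1" "fconst (- c) = - fconst c"
  by (simp_all add: fconst_def single_add mult_single single_uminus)

lemma fconst_diff: "fconst (c - d) = fconst c - fconst d"
  by (simp add: fconst_def single_diff)

lemma fconst_commute: "p * fconst c = fconst c * p"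
  by (induction p rule: free_algebra_add_induct)
     (simp_all add: fconst_def mult_single mult.commute distrib_left distrib_right)

lemma free_action_add: "free_action \<rho> (p + q) v = free_action \<rho> p v + free_action \<rho> q v"
proof -
  let ?S = "Poly_Mapping.keys p \<union> Poly_Mapping.keys q"
  let ?W = "\<lambda>w. foldr (\<lambda>y u. \<rho> y *v u) (letters w) v"
  have *: "free_action \<rho> r v = (\<Sum>w\<in>?S. Poly_Mapping.lookup r w *s ?W w)"
    if "Poly_Mapping.keys r \<subseteq> ?S" for r
    unfolding free_action_def
    by (rule sum.mono_neutral_left) (use that in \<open>auto simp: in_keys_iff\<close>)
  have "Poly_Mapping.keys (p + q) \<subseteq> ?S" by (rule keys_add)
  then show ?thesis
    by (simp add: * lookup_add vector_sadd_rdistrib sum.distrib)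
qed

lemma free_action_single:
  "free_action \<rho> (Poly_Mapping.single w c) v = c *s foldr (\<lambda>y u. \<rho> y *v u) (letters w) v"
  by (simp add: free_action_def)

lemma free_action_gen [simp]: "free_action \<rho> (fgen y) v = \<rho> y *v v"
  by (simp add: fgen_def free_action_single)

lemma free_action_const [simp]: "free_action \<rho> (fconst c) v = c *s v"
  by (simp add: fconst_def free_action_single zero_fmonoid_def)

lemma free_action_0 [simp]: "free_action \<rho> 0 v = 0"
  by (simp add: free_action_def)

lemma free_action_1 [simp]: "free_action \<rho> 1 v = v"
  using free_action_const[of \<rho> 1 v] by (simp only: fconst_simps vector_smult_lid)

lemma word_linear:
  fixes \<rho> :: "'g \<Rightarrow> 'k::field^'n^'n"
  shows "foldr (\<lambda>y u. \<rho> y *v u) ys (c *s u + v) =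
    c *s foldr (\<lambda>y u. \<rho> y *v u) ys u + foldr (\<lambda>y u. \<rho> y *v u) ys v"
  by (induction ys) (simp_all add: vec.add vec.scale)

lemma word_0: "foldr (\<lambda>y u. \<rho> y *v u) ys 0 = (0 :: 'k::field^'n)"
  by (induction ys) simp_all

lemma free_action_linear:
  "free_action \<rho> p (c *s u + v) = c *s free_action \<rho> p u + free_action \<rho> p v"
  by (induction p rule: free_algebra_add_induct)
     (simp_all add: free_action_add free_action_single word_linear vec.scale_right_distrib
        vector_smult_assoc mult.commute)

lemma free_action_diff: "free_action \<rho> (p - q) v = free_action \<rho> p v - free_action \<rho> q v"
  using free_action_add[of \<rho> "p - q" q v] by simp

lemma free_action_mult: "free_action \<rho> (p * q) v = free_action \<rho> p (free_action \<rho> q v)"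
proof (induction p rule: free_algebra_add_induct)
  case (1 w c)
  show ?case
  proof (induction q rule: free_algebra_add_induct)
    case (1 w' c')
    show ?case
      using word_linear[of \<rho> "letters w" c' _ 0]
      by (simp add: word_0 mult_single free_action_single plus_fmonoid_def vector_smult_assoc)
  next
    case (2 q q')
    then show ?case
      using free_action_linear[of \<rho> _ 1] by (simp add: distrib_left free_action_add)
  qed
next
  case (2 p p')
  then show ?case by (simp add: distrib_right free_action_add)
qed

lemma free_action_uminus: "free_action \<rho> (- p) v = - free_action \<rho> p v"
  using free_action_diff[of \<rho> 0 p v] by simp

section \<open>Homomorphisms of left modules\<close>

lemma left_moduleD:
  assumes "left_module R M"
  shows "ring R" "abelian_group M"
    "\<And>r x. r \<in> carrier R \<Longrightarrow> x \<in> carrier M \<Longrightarrow> r \<odot>\<^bsub>M\<^esub> x \<in> carrier M"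
    "\<And>r r' x. r \<in> carrier R \<Longrightarrow> r' \<in> carrier R \<Longrightarrow> x \<in> carrier M \<Longrightarrow>
        (r \<oplus>\<^bsub>R\<^esub> r') \<odot>\<^bsub>M\<^esub> x = (r \<odot>\<^bsub>M\<^esub> x) \<oplus>\<^bsub>M\<^esub> (r' \<odot>\<^bsub>M\<^esub> x)"
    "\<And>r x y. r \<in> carrier R \<Longrightarrow> x \<in> carrier M \<Longrightarrow> y \<in> carrier M \<Longrightarrow>
        r \<odot>\<^bsub>M\<^esub> (x \<oplus>\<^bsub>M\<^esub> y) = (r \<odot>\<^bsub>M\<^esub> x) \<oplus>\<^bsub>M\<^esub> (r \<odot>\<^bsub>M\<^esub> y)"
    "\<And>r r' x. r \<in> carrier R \<Longrightarrow> r' \<in> carrier R \<Longrightarrow> x \<in> carrier M \<Longrightarrow>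
        (r \<otimes>\<^bsub>R\<^esub> r') \<odot>\<^bsub>M\<^esub> x = r \<odot>\<^bsub>M\<^esub> (r' \<odot>\<^bsub>M\<^esub> x)"
    "\<And>x. x \<in> carrier M \<Longrightarrow> \<one>\<^bsub>R\<^esub> \<odot>\<^bsub>M\<^esub> x = x"
  using assms unfolding left_module_def by blast+

lemma left_module_smult_zero:
  assumes "left_module R M" "r \<in> carrier R"
  shows "r \<odot>\<^bsub>M\<^esub> \<zero>\<^bsub>M\<^esub> = \<zero>\<^bsub>M\<^esub>"
proof -
  interpret M: abelian_group M using left_moduleD(2)[OF assms(1)] .
  have "r \<odot>\<^bsub>M\<^esub> \<zero>\<^bsub>M\<^esub> \<oplus>\<^bsub>M\<^esub> r \<odot>\<^bsub>M\<^esub> \<zero>\<^bsub>M\<^esub> = r \<odot>\<^bsub>M\<^esub> \<zero>\<^bsub>M\<^esub>"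
    using left_moduleD(5)[OF assms, of "\<zero>\<^bsub>M\<^esub>" "\<zero>\<^bsub>M\<^esub>"] by simp
  then show ?thesis
    using left_moduleD(3)[OF assms, of "\<zero>\<^bsub>M\<^esub>"] by (metis M.add.l_cancel_one' M.zero_closed)
qed

lemma left_module_zero_smult:
  assumes "left_module R M" "x \<in> carrier M"
  shows "\<zero>\<^bsub>R\<^esub> \<odot>\<^bsub>M\<^esub> x = \<zero>\<^bsub>M\<^esub>"
proof -
  interpret M: abelian_group M using left_moduleD(2)[OF assms(1)] .
  interpret R: ring R using left_moduleD(1)[OF assms(1)] .
  have "\<zero>\<^bsub>R\<^esub> \<odot>\<^bsub>M\<^esub> x \<oplus>\<^bsub>M\<^esub> \<zero>\<^bsub>R\<^esub> \<odot>\<^bsub>M\<^esub> x = \<zero>\<^bsub>R\<^esub> \<odot>\<^bsub>M\<^esub> x"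
    using left_moduleD(4)[OF assms(1), of "\<zero>\<^bsub>R\<^esub>" "\<zero>\<^bsub>R\<^esub>" x] assms(2) by simp
  then show ?thesis
    using left_moduleD(3)[OF assms(1) R.zero_closed assms(2)] by (metis M.add.l_cancel_one')
qed

lemma left_module_neg:
  assumes "left_module R M" "x \<in> carrier M"
  shows "(\<ominus>\<^bsub>R\<^esub> \<one>\<^bsub>R\<^esub>) \<odot>\<^bsub>M\<^esub> x = \<ominus>\<^bsub>M\<^esub> x"
proof -
  interpret M: abelian_group M using left_moduleD(2)[OF assms(1)] .
  interpret R: ring R using left_moduleD(1)[OF assms(1)] .
  have "(\<ominus>\<^bsub>R\<^esub> \<one>\<^bsub>R\<^esub>) \<odot>\<^bsub>M\<^esub> x \<oplus>\<^bsub>M\<^esub> x = \<zero>\<^bsub>M\<^esub>"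
    using left_moduleD(4)[OF assms(1), of "\<ominus>\<^bsub>R\<^esub> \<one>\<^bsub>R\<^esub>" "\<one>\<^bsub>R\<^esub>" x] left_moduleD(7)[OF assms]
      left_module_zero_smult[OF assms] assms(2) by (simp add: R.l_neg)
  then show ?thesis
    using left_moduleD(3)[OF assms(1) _ assms(2), of "\<ominus>\<^bsub>R\<^esub> \<one>\<^bsub>R\<^esub>"] assms(2)
    by (metis M.minus_equality R.a_inv_closed R.one_closed)
qed

lemma left_submoduleI:
  assumes "left_module R M" "N \<subseteq> carrier M" "\<zero>\<^bsub>M\<^esub> \<in> N"
    and "\<And>x y. x \<in> N \<Longrightarrow> y \<in> N \<Longrightarrow> x \<oplus>\<^bsub>M\<^esub> y \<in> N"
    and smult: "\<And>r x. r \<in> carrier R \<Longrightarrow> x \<in> N \<Longrightarrow> r \<odot>\<^bsub>M\<^esub> x \<in> N"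
  shows "submodule N R M"
proof -
  interpret R: ring R using left_moduleD(1)[OF assms(1)] .
  have inv: "\<ominus>\<^bsub>M\<^esub> x \<in> N" if "x \<in> N" for x
    using left_module_neg[OF assms(1), of x] smult[of "\<ominus>\<^bsub>R\<^esub> \<one>\<^bsub>R\<^esub>" x] that assms(2) by auto
  have "subgroup N (add_monoid M)"
    by (rule subgroup.intro) (use assms inv in \<open>auto simp: a_inv_def\<close>)
  then show ?thesis
    by (auto intro!: submodule.intro submodule_axioms.intro smult)
qed

lemma submoduleD:
  assumes "submodule N R M"
  shows "N \<subseteq> carrier M" "\<zero>\<^bsub>M\<^esub> \<in> N"
    "\<And>x y. x \<in> N \<Longrightarrow> y \<in> N \<Longrightarrow> x \<oplus>\<^bsub>M\<^esub> y \<in> N"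
    "\<And>r x. r \<in> carrier R \<Longrightarrow> x \<in> N \<Longrightarrow> r \<odot>\<^bsub>M\<^esub> x \<in> N"
  using subgroup.subset[OF submodule.axioms(1)[OF assms]]
    subgroup.one_closed[OF submodule.axioms(1)[OF assms]]
    subgroup.m_closed[OF submodule.axioms(1)[OF assms]]
    submodule.smult_closed[OF assms]
  by auto

lemma simple_left_moduleD:
  assumes "simple_left_module R M"
  shows "left_module R M" "carrier M \<noteq> {\<zero>\<^bsub>M\<^esub>}"
    "\<And>N. submodule N R M \<Longrightarrow> N = {\<zero>\<^bsub>M\<^esub>} \<or> N = carrier M"
  using assms by (auto simp: simple_left_module_def)

definition module_hom ::
  "('a, 'r) ring_scheme \<Rightarrow> ('a, 'm) module \<Rightarrow> ('a, 'n) module \<Rightarrow> ('m \<Rightarrow> 'n) \<Rightarrow> bool" where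
  "module_hom R M N f \<longleftrightarrow> f ` carrier M \<subseteq> carrier N \<and>
     (\<forall>x\<in>carrier M. \<forall>y\<in>carrier M. f (x \<oplus>\<^bsub>M\<^esub> y) = f x \<oplus>\<^bsub>N\<^esub> f y) \<and>
     (\<forall>r\<in>carrier R. \<forall>x\<in>carrier M. f (r \<odot>\<^bsub>M\<^esub> x) = r \<odot>\<^bsub>N\<^esub> f x)"

lemma module_homD:
  assumes "module_hom R M N f"
  shows "\<And>x. x \<in> carrier M \<Longrightarrow> f x \<in> carrier N"
    "\<And>x y. x \<in> carrier M \<Longrightarrow> y \<in> carrier M \<Longrightarrow> f (x \<oplus>\<^bsub>M\<^esub> y) = f x \<oplus>\<^bsub>N\<^esub> f y"
    "\<And>r x. r \<in> carrier R \<Longrightarrow> x \<in> carrier M \<Longrightarrow> f (r \<odot>\<^bsub>M\<^esub> x) = r \<odot>\<^bsub>N\<^esub> f x"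
  using assms by (auto simp: module_hom_def)

lemma module_iso_iff_hom:
  "module_iso R M N \<longleftrightarrow> (\<exists>f. bij_betw f (carrier M) (carrier N) \<and> module_hom R M N f)"
  unfolding module_iso_def module_hom_def by (auto simp: bij_betw_def)

lemma module_hom_zero:
  assumes "left_module R M" "left_module R N" "module_hom R M N f"
  shows "f \<zero>\<^bsub>M\<^esub> = \<zero>\<^bsub>N\<^esub>"
proof -
  interpret M: abelian_group M using left_moduleD(2)[OF assms(1)] .
  interpret R: ring R using left_moduleD(1)[OF assms(1)] .
  have "f (\<zero>\<^bsub>R\<^esub> \<odot>\<^bsub>M\<^esub> \<zero>\<^bsub>M\<^esub>) = \<zero>\<^bsub>R\<^esub> \<odot>\<^bsub>N\<^esub> f \<zero>\<^bsub>M\<^esub>"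
    using module_homD(3)[OF assms(3)] by simp
  then show ?thesis
    using left_module_zero_smult[OF assms(1)] left_module_zero_smult[OF assms(2)]
      module_homD(1)[OF assms(3)] by simp
qed

lemma submodule_image:
  assumes "left_module R M" "left_module R N" "module_hom R M N f" "submodule K R M"
  shows "submodule (f ` K) R N"
proof (rule left_submoduleI[OF assms(2)])
  note K = submoduleD[OF assms(4)] and f = module_homD[OF assms(3)]
  show "f ` K \<subseteq> carrier N" using K(1) f(1) by auto
  show "\<zero>\<^bsub>N\<^esub> \<in> f ` K" using module_hom_zero[OF assms(1-3)] K(2) by (metis imageI)
  show "x \<oplus>\<^bsub>N\<^esub> y \<in> f ` K" if "x \<in> f ` K" "y \<in> f ` K" for x y
    using that K(1,3) f(2) by (auto simp: subset_iff image_iff) metis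
  show "r \<odot>\<^bsub>N\<^esub> x \<in> f ` K" if "r \<in> carrier R" "x \<in> f ` K" for r x
    using that K(1,4) f(3) by (auto simp: subset_iff image_iff) metis
qed

lemma submodule_vimage:
  assumes "left_module R M" "left_module R N" "module_hom R M N f" "submodule K R N"
  shows "submodule {x \<in> carrier M. f x \<in> K} R M"
proof (rule left_submoduleI[OF assms(1)])
  interpret M: abelian_group M using left_moduleD(2)[OF assms(1)] .
  note K = submoduleD[OF assms(4)] and f = module_homD[OF assms(3)]
  show "\<zero>\<^bsub>M\<^esub> \<in> {x \<in> carrier M. f x \<in> K}" using module_hom_zero[OF assms(1-3)] K(2) by simp
qed (use submoduleD[OF assms(4)] module_homD[OF assms(3)] left_moduleD(2,3)[OF assms(1)] in
      \<open>auto simp: abelian_group.axioms(1) intro: abelian_monoid.a_closed\<close>)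

lemma submodule_zero:
  assumes "left_module R M"
  shows "submodule {\<zero>\<^bsub>M\<^esub>} R M"
proof -
  interpret M: abelian_group M using left_moduleD(2)[OF assms] .
  show ?thesis
    by (rule left_submoduleI[OF assms]) (auto simp: left_module_smult_zero[OF assms])
qed

lemma submodule_carrier:
  assumes "left_module R M"
  shows "submodule (carrier M) R M"
proof -
  interpret M: abelian_group M using left_moduleD(2)[OF assms] .
  show ?thesis
    by (rule left_submoduleI[OF assms]) (auto simp: left_moduleD(3)[OF assms])
qed

text \<open>
  Kernel and image are submodules; a nonzero \<open>f\<close> has kernel not everything and image not zero,
  so by simplicity of both sides the kernel is zero and the image everything.
\<close>

lemma Schur:
  assumes M: "simple_left_module R M" and N: "simple_left_module R N"
    and f: "module_hom R M N f" and nz: "x \<in> carrier M" "f x \<noteq> \<zero>\<^bsub>N\<^esub>"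
  shows "module_iso R M N"
proof -
  note LM = simple_left_moduleD(1)[OF M] and LN = simple_left_moduleD(1)[OF N]
  interpret M: abelian_group M using left_moduleD(2)[OF LM] .
  interpret N: abelian_group N using left_moduleD(2)[OF LN] .
  have f0: "f \<zero>\<^bsub>M\<^esub> = \<zero>\<^bsub>N\<^esub>" by (rule module_hom_zero[OF LM LN f])
  have ker: "{y \<in> carrier M. f y \<in> {\<zero>\<^bsub>N\<^esub>}} = {\<zero>\<^bsub>M\<^esub>}"
    using simple_left_moduleD(3)[OF M submodule_vimage[OF LM LN f submodule_zero[OF LN]]] nz by auto
  have "f ` carrier M = carrier N"
    using simple_left_moduleD(3)[OF N submodule_image[OF LM LN f submodule_carrier[OF LM]]] nz by auto
  moreover have "inj_on f (carrier M)"
  proof (rule inj_onI)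
    fix y z assume yz: "y \<in> carrier M" "z \<in> carrier M" "f y = f z"
    have neg: "f (\<ominus>\<^bsub>M\<^esub> z) = \<ominus>\<^bsub>N\<^esub> f z"
      using module_homD(2)[OF f, of "\<ominus>\<^bsub>M\<^esub> z" z] yz f0 module_homD(1)[OF f]
      by (simp add: M.l_neg) (metis M.a_inv_closed N.minus_equality)
    have "f (y \<oplus>\<^bsub>M\<^esub> \<ominus>\<^bsub>M\<^esub> z) = \<zero>\<^bsub>N\<^esub>"
      using module_homD(2)[OF f, of y "\<ominus>\<^bsub>M\<^esub> z"] module_homD(1)[OF f] yz neg by (simp add: N.r_neg)
    then have "y \<oplus>\<^bsub>M\<^esub> \<ominus>\<^bsub>M\<^esub> z = \<zero>\<^bsub>M\<^esub>" using ker yz by auto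
    then show "y = z" using yz by (metis M.a_inv_closed M.minus_equality M.minus_minus)
  qed
  ultimately show ?thesis using f by (auto simp: module_iso_iff_hom bij_betw_def)
qed

lemma module_iso_refl: "module_iso R M M"
  unfolding module_iso_def by (intro exI[of _ id]) auto

lemma module_iso_trans: "module_iso R M N \<Longrightarrow> module_iso R N P \<Longrightarrow> module_iso R M P"
  unfolding module_iso_iff_hom module_hom_def
  by (elim exE, rule_tac x = "fa \<circ> f" in exI) (auto simp: bij_betw_trans image_subset_iff)

lemma module_iso_sym:
  assumes "left_module R M" "module_iso R M N"
  shows "module_iso R N M"
proof -
  interpret M: abelian_group M using left_moduleD(2)[OF assms(1)] .
  obtain f where f: "bij_betw f (carrier M) (carrier N)" "module_hom R M N f"
    using assms(2) by (auto simp: module_iso_iff_hom)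
  define g where "g = inv_into (carrier M) f"
  have g: "bij_betw g (carrier N) (carrier M)"
    unfolding g_def by (rule bij_betw_inv_into[OF f(1)])
  have fg: "f (g y) = y" "g y \<in> carrier M" if "y \<in> carrier N" for y
    using that f(1) g by (auto simp: g_def bij_betw_inv_into_right bij_betw_apply)
  have gf: "g (f x) = x" if "x \<in> carrier M" for x
    using that f(1) by (simp add: g_def bij_betw_inv_into_left)
  show ?thesis
    unfolding module_iso_def
  proof (intro exI[of _ g] conjI ballI g)
    fix x y assume "x \<in> carrier N" "y \<in> carrier N"
    then show "g (x \<oplus>\<^bsub>N\<^esub> y) = g x \<oplus>\<^bsub>M\<^esub> g y"
      using fg[of x] fg[of y] module_homD(2)[OF f(2), of "g x" "g y"] gf[of "g x \<oplus>\<^bsub>M\<^esub> g y"] by simp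
  next
    fix r x assume "r \<in> carrier R" "x \<in> carrier N"
    then show "g (r \<odot>\<^bsub>N\<^esub> x) = r \<odot>\<^bsub>M\<^esub> g x"
      using fg[of x] module_homD(3)[OF f(2), of r "g x"] gf[of "r \<odot>\<^bsub>M\<^esub> g x"]
        left_moduleD(3)[OF assms(1), of r "g x"] by simp
  qed
qed

lemma simple_left_module_iso:
  assumes "simple_left_module R M" "left_module R N" "module_iso R M N"
  shows "simple_left_module R N"
proof -
  note LM = simple_left_moduleD(1)[OF assms(1)]
  obtain f where f: "bij_betw f (carrier M) (carrier N)" "module_hom R M N f"
    using assms(3) by (auto simp: module_iso_iff_hom)
  have f0: "f \<zero>\<^bsub>M\<^esub> = \<zero>\<^bsub>N\<^esub>" by (rule module_hom_zero[OF LM assms(2) f(2)])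
  have img: "f ` {x \<in> carrier M. f x \<in> K} = K" if "K \<subseteq> carrier N" for K
    using that f(1) by (auto simp: bij_betw_def)
  have z: "\<zero>\<^bsub>M\<^esub> \<in> carrier M" using submoduleD(2)[OF submodule_carrier[OF LM]] .
  show ?thesis
    unfolding simple_left_module_def
  proof (intro conjI allI impI assms(2))
    show "carrier N \<noteq> {\<zero>\<^bsub>N\<^esub>}"
    proof
      assume N: "carrier N = {\<zero>\<^bsub>N\<^esub>}"
      have "x = \<zero>\<^bsub>M\<^esub>" if x: "x \<in> carrier M" for x
      proof -
        have "f x = f \<zero>\<^bsub>M\<^esub>" using module_homD(1)[OF f(2) x] N f0 by simp
        then show ?thesis using x z f(1) by (metis bij_betw_imp_inj_on inj_on_def)
      qed
      then show False using z simple_left_moduleD(2)[OF assms(1)] by blast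
    qed
    fix K assume K: "submodule K R N"
    define K' where "K' = {x \<in> carrier M. f x \<in> K}"
    have "K' = {\<zero>\<^bsub>M\<^esub>} \<or> K' = carrier M"
      using simple_left_moduleD(3)[OF assms(1) submodule_vimage[OF LM assms(2) f(2) K]]
      by (simp add: K'_def)
    moreover have "K = f ` K'" using img[OF submoduleD(1)[OF K]] by (simp add: K'_def)
    ultimately show "K = {\<zero>\<^bsub>N\<^esub>} \<or> K = carrier N" using f0 f(1) by (auto simp: bij_betw_def)
  qed
qed

text \<open>
  Conjugating the operations by \<open>e\<close> puts a copy of \<open>M\<close> on every type with enough elements.
\<close>

lemma transport_left_module:
  fixes M :: "('a, 'm) module" and e :: "'m \<Rightarrow> 'n"
  assumes "left_module R M" "inj_on e (carrier M)"
  shows "\<exists>N :: (_, 'n) module. left_module R N \<and> module_iso R M N"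
proof -
  interpret M: abelian_group M using left_moduleD(2)[OF assms(1)] .
  define g where "g = inv_into (carrier M) e"
  have g [simp]: "g (e x) = x" if "x \<in> carrier M" for x
    using assms(2) that by (simp add: g_def)
  define N :: "('a, 'n) module" where "N = \<lparr>carrier = e ` carrier M, mult = undefined, one = undefined,
    zero = e \<zero>\<^bsub>M\<^esub>, add = (\<lambda>x y. e (g x \<oplus>\<^bsub>M\<^esub> g y)), smult = (\<lambda>r x. e (r \<odot>\<^bsub>M\<^esub> g x))\<rparr>"
  have "abelian_group N"
  proof (rule abelian_groupI)
    show "\<exists>y\<in>carrier N. y \<oplus>\<^bsub>N\<^esub> x = \<zero>\<^bsub>N\<^esub>" if x: "x \<in> carrier N" for x
      using x by (auto simp: N_def M.l_neg intro!: bexI[of _ "\<ominus>\<^bsub>M\<^esub> g x"])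
  qed (auto simp: N_def M.a_ac)
  then have "left_module R N"
    using left_moduleD[OF assms(1)] by (auto simp: left_module_def N_def)
  moreover have "module_iso R M N"
    unfolding module_iso_def using assms(2) left_moduleD(3)[OF assms(1)]
    by (intro exI[of _ e]) (auto simp: N_def bij_betw_def)
  ultimately show ?thesis by blast
qed

section \<open>Modules given by matrices\<close>

definition satisfies_relations ::
  "('g \<Rightarrow> 'k::field^'n^'n) \<Rightarrow> ('g, 'k) relations \<Rightarrow> bool" where
  "satisfies_relations \<rho> Rel \<longleftrightarrow>
     (\<forall>(l, r)\<in>Rel. \<forall>v. free_action \<rho> l v = free_action \<rho> r v)"

lemma matrix_module_simps [simp]:
  "carrier (matrix_module \<rho>) = UNIV" "zero (matrix_module \<rho>) = 0"
  "add (matrix_module \<rho>) = (+)"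
  by (simp_all add: matrix_module_def)

text \<open>
  The elements of the free algebra that act as zero form a two-sided ideal. It contains the
  differences of the relations, hence the whole relation ideal, so all representatives of a coset
  act in the same way.
\<close>

lemma smult_matrix_module:
  assumes "satisfies_relations \<rho> Rel"
  shows "residue_class Rel p \<odot>\<^bsub>matrix_module \<rho>\<^esub> v = free_action \<rho> p v"
proof -
  let ?I = "{p. \<forall>v. free_action \<rho> p v = 0}"
  have z: "free_action \<rho> p 0 = 0" for p
    using free_action_linear[of \<rho> p "- 1" 0 0] by simp
  have "ideal ?I ring_of_type_algebra"
    by (rule ideal_ring_of_type_algebraI) (auto simp: free_action_diff free_action_mult z)
  moreover have "l - r \<in> ?I" if "(l, r) \<in> Rel" for l r
    using assms that by (auto simp: satisfies_relations_def free_action_diff)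
  ultimately have "relation_ideal Rel \<subseteq> ?I"
    by (rule relation_ideal_minimal)
  then have "free_action \<rho> ((SOME p'. p' \<in> residue_class Rel p) - p) v = 0"
    using some_in_residue_class[of Rel p] by blast
  then show ?thesis by (simp add: matrix_module_def free_action_diff)
qed

lemma left_module_matrix_module:
  fixes \<rho> :: "'g \<Rightarrow> 'k::field^'n^'n"
  assumes "satisfies_relations \<rho> Rel"
  shows "left_module (presented_algebra Rel) (matrix_module \<rho>)"
proof -
  have "abelian_group (matrix_module \<rho>)"
  proof (rule abelian_groupI)
    fix x :: "'k^'n"
    show "\<exists>y\<in>carrier (matrix_module \<rho>). y \<oplus>\<^bsub>matrix_module \<rho>\<^esub> x = \<zero>\<^bsub>matrix_module \<rho>\<^esub>"
      by (simp add: exI[of _ "- x"])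
  qed (simp_all add: add_ac)
  moreover have "free_action \<rho> p (u + v) = free_action \<rho> p u + free_action \<rho> p v" for p u v
    using free_action_linear[of \<rho> p 1 u v] by simp
  ultimately show ?thesis
    unfolding left_module_def residue_class_ball
    by (simp add: ring_presented_algebra smult_matrix_module[OF assms] free_action_add
        free_action_mult flip: residue_class_simps(2-4))
qed

text \<open>
  Simplicity in the form in which it is easiest to check: every nonzero vector generates.
\<close>

lemma simple_matrix_module:
  fixes \<rho> :: "'g \<Rightarrow> 'k::field^'n^'n"
  assumes "satisfies_relations \<rho> Rel"
    and trans: "\<And>v u. v \<noteq> 0 \<Longrightarrow> \<exists>p. free_action \<rho> p v = u"
  shows "simple_left_module (presented_algebra Rel) (matrix_module \<rho>)"
  unfolding simple_left_module_def
proof (intro conjI allI impI)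
  show "left_module (presented_algebra Rel) (matrix_module \<rho>)"
    by (rule left_module_matrix_module[OF assms(1)])
  have "(\<chi> i. 1) \<noteq> (0 :: 'k^'n)" by (simp add: vec_eq_iff)
  then show "carrier (matrix_module \<rho>) \<noteq> {\<zero>\<^bsub>matrix_module \<rho>\<^esub>}" by auto
  fix N assume N: "submodule N (presented_algebra Rel) (matrix_module \<rho>)"
  have "N = UNIV" if v: "v \<in> N" "v \<noteq> 0" for v
  proof -
    have "u \<in> N" for u
    proof -
      obtain p where "free_action \<rho> p v = u" using trans[OF v(2)] by blast
      then show ?thesis
        using submoduleD(4)[OF N residue_class_simps(1) v(1), of p]
        by (simp add: smult_matrix_module[OF assms(1)])
    qed
    then show ?thesis by auto
  qed
  then show "N = {\<zero>\<^bsub>matrix_module \<rho>\<^esub>} \<or> N = carrier (matrix_module \<rho>)"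
    using submoduleD(2)[OF N] by auto
qed

lemma module_iso_matrix_moduleE:
  assumes "satisfies_relations \<rho> Rel" "satisfies_relations \<sigma> Rel"
    and "module_iso (presented_algebra Rel) (matrix_module \<rho>) (matrix_module \<sigma>)"
  obtains f where "bij f" "f 0 = 0" "\<And>c v. f (c *s v) = c *s f v" "\<And>y v. f (\<rho> y *v v) = \<sigma> y *v f v"
proof -
  obtain f where f: "bij f" "module_hom (presented_algebra Rel) (matrix_module \<rho>) (matrix_module \<sigma>) f"
    using assms(3) by (auto simp: module_iso_iff_hom)
  have eq: "f (free_action \<rho> p v) = free_action \<sigma> p (f v)" for p v
    using module_homD(3)[OF f(2) residue_class_simps(1), of v p]
    by (simp add: smult_matrix_module[OF assms(1)] smult_matrix_module[OF assms(2)])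
  show ?thesis
  proof (rule that[OF f(1)])
    show "f 0 = 0"
      using module_hom_zero[OF left_module_matrix_module left_module_matrix_module f(2)] assms by simp
    show "f (c *s v) = c *s f v" "f (\<rho> y *v v) = \<sigma> y *v f v" for c v y
      using eq[of "fconst c" v] eq[of "fgen y" v] by simp_all
  qed
qed

section \<open>Arbitrary modules over a presented algebra\<close>

locale presented_module =
  fixes Rel :: "('g, 'k::field) relations"
    and M :: "(('g, 'k) free_algebra set, 'm) module" (structure)
  assumes left_module: "left_module (presented_algebra Rel) M"
begin

sublocale abelian_group M
  by (rule left_moduleD(2)[OF left_module])

definition act :: "('g, 'k) free_algebra \<Rightarrow> 'm \<Rightarrow> 'm"  (infixr \<open>\<triangleright>\<close> 75) where
  "p \<triangleright> x = residue_class Rel p \<odot>\<^bsub>M\<^esub> x"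

lemma act_closed [simp, intro]: "x \<in> carrier M \<Longrightarrow> p \<triangleright> x \<in> carrier M"
  unfolding act_def using left_moduleD(3)[OF left_module] residue_class_simps(1) by blast

lemma act_add_left: "x \<in> carrier M \<Longrightarrow> (p + q) \<triangleright> x = p \<triangleright> x \<oplus> q \<triangleright> x"
  unfolding act_def residue_class_simps
  using left_moduleD(4)[OF left_module] residue_class_simps(1) by blast

lemma act_add: "x \<in> carrier M \<Longrightarrow> y \<in> carrier M \<Longrightarrow> p \<triangleright> (x \<oplus> y) = p \<triangleright> x \<oplus> p \<triangleright> y"
  unfolding act_def using left_moduleD(5)[OF left_module] residue_class_simps(1) by blast

lemma act_mult: "x \<in> carrier M \<Longrightarrow> (p * q) \<triangleright> x = p \<triangleright> q \<triangleright> x"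
  unfolding act_def residue_class_simps
  using left_moduleD(6)[OF left_module] residue_class_simps(1) by blast

lemma act_1 [simp]: "x \<in> carrier M \<Longrightarrow> 1 \<triangleright> x = x"
  unfolding act_def residue_class_simps using left_moduleD(7)[OF left_module] by blast

lemma act_zero [simp]: "p \<triangleright> \<zero> = \<zero>"
  unfolding act_def by (rule left_module_smult_zero[OF left_module residue_class_simps(1)])

lemma act_0 [simp]: "x \<in> carrier M \<Longrightarrow> 0 \<triangleright> x = \<zero>"
  using act_add_left[of x 0 0] act_closed[of x 0] by (metis add.l_cancel_one' add_0)

lemma act_relation: "(l, r) \<in> Rel \<Longrightarrow> l \<triangleright> x = r \<triangleright> x"
  by (simp add: act_def residue_class_relation)

lemma act_uminus: "x \<in> carrier M \<Longrightarrow> (- p) \<triangleright> x = \<ominus> (p \<triangleright> x)"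
  using act_add_left[of x "- p" p] act_0[of x] by (metis act_closed add.left_inverse minus_equality)

lemma act_diff: "x \<in> carrier M \<Longrightarrow> (p - q) \<triangleright> x = p \<triangleright> x \<ominus> q \<triangleright> x"
  using act_add_left[of x p "- q"] by (simp add: act_uminus minus_eq)

lemma act_sum:
  assumes "finite A" "x \<in> carrier M" "\<And>i. i \<in> A \<Longrightarrow> f i \<triangleright> x \<in> N" "\<zero> \<in> N"
    and "\<And>y z. y \<in> N \<Longrightarrow> z \<in> N \<Longrightarrow> y \<oplus> z \<in> N"
  shows "sum f A \<triangleright> x \<in> N"
  using assms(1,3) by (induction A rule: finite_induct) (auto simp: assms act_add_left)

lemma act_fconst_commute: "x \<in> carrier M \<Longrightarrow> p \<triangleright> fconst c \<triangleright> x = fconst c \<triangleright> p \<triangleright> x"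
  by (simp flip: act_mult add: fconst_commute)

lemma act_fconst_eq_zero:
  assumes "x \<in> carrier M" "c \<noteq> 0" "fconst c \<triangleright> x = \<zero>"
  shows "x = \<zero>"
proof -
  have "fconst (inverse c) \<triangleright> fconst c \<triangleright> x = x"
    using assms(1,2) by (simp flip: act_mult fconst_simps(2) add: fconst_simps(4))
  then show ?thesis using assms(3) by simp
qed

lemma act_fconst_cancel:
  assumes "x \<in> carrier M" "x \<noteq> \<zero>" "fconst c \<triangleright> x = fconst d \<triangleright> x"
  shows "c = d"
proof -
  have "fconst (c - d) \<triangleright> x = \<zero>"
    using assms(1,3) by (simp add: fconst_diff act_diff r_neg minus_eq)
  then show ?thesis using act_fconst_eq_zero[OF assms(1), of "c - d"] assms(2) by auto
qed

text \<open>
  The rules collected as \<open>act_normalize\<close> bring an element of a module to the form of a sum of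
  terms \<open>fconst k \<triangleright> y1 \<triangleright> \<dots> \<triangleright> yn \<triangleright> v\<close> with one scalar in front of a word of generators. Full
  commutation of scalars would make rewriting loop on two scalars; moving them only past
  generators terminates.
\<close>

lemma act_gen_fconst: "x \<in> carrier M \<Longrightarrow> fgen y \<triangleright> fconst c \<triangleright> x = fconst c \<triangleright> fgen y \<triangleright> x"
  by (rule act_fconst_commute)

lemma act_fconst_fconst: "x \<in> carrier M \<Longrightarrow> fconst c \<triangleright> fconst d \<triangleright> x = fconst (c * d) \<triangleright> x"
  by (simp add: fconst_simps act_mult)

lemma act_fconst_add: "x \<in> carrier M \<Longrightarrow> fconst c \<triangleright> x \<oplus> fconst d \<triangleright> x = fconst (c + d) \<triangleright> x"
  by (simp add: fconst_simps act_add_left)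

lemma act_neg: "x \<in> carrier M \<Longrightarrow> (- p) \<triangleright> x = fconst (- 1) \<triangleright> p \<triangleright> x"
  by (simp add: fconst_simps(4,5) act_uminus)

lemma act_minus: "x \<in> carrier M \<Longrightarrow> (p - q) \<triangleright> x = p \<triangleright> x \<oplus> fconst (- 1) \<triangleright> q \<triangleright> x"
  by (simp add: act_diff minus_eq act_neg[symmetric] act_uminus)

lemmas act_normalize =
  act_mult act_add_left act_minus act_neg act_add act_gen_fconst act_fconst_fconst act_fconst_add

lemma eigenspace_stable:
  assumes "x \<in> carrier M" "p \<triangleright> x = fconst c \<triangleright> x" "(p * q) \<triangleright> x = (q * p) \<triangleright> x"
  shows "p \<triangleright> q \<triangleright> x = fconst c \<triangleright> q \<triangleright> x"
  using assms by (simp add: act_mult act_fconst_commute)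

definition subspace :: "'m set \<Rightarrow> bool" where
  "subspace K \<longleftrightarrow> K \<subseteq> carrier M \<and> \<zero> \<in> K \<and> (\<forall>x\<in>K. \<forall>y\<in>K. x \<oplus> y \<in> K) \<and>
     (\<forall>c. \<forall>x\<in>K. fconst c \<triangleright> x \<in> K)"

lemma subspace_eigenspace:
  assumes "subspace K"
  shows "subspace {x \<in> K. p \<triangleright> x = fconst c \<triangleright> x}"
proof -
  have "p \<triangleright> fconst d \<triangleright> x = fconst c \<triangleright> fconst d \<triangleright> x"
    if "x \<in> carrier M" "p \<triangleright> x = fconst c \<triangleright> x" for d x
    using act_fconst_commute[OF that(1), of p d] act_fconst_commute[OF that(1), of "fconst c" d]
      that(2) by simp
  then show ?thesis
    using assms unfolding subspace_def by (auto simp: act_add subset_iff)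
qed

text \<open>
  With \<open>e r = (\<Sum>i<n. inverse z ^ (r * i) * y ^ i)\<close> one has \<open>y * e r = z ^ r * e r\<close> modulo \<open>y ^ n - 1\<close>,
  because multiplying by \<open>y\<close> shifts the summation index cyclically, and \<open>(\<Sum>r<n. e r) = n\<close>, because
  the sum over all \<open>r\<close> of \<open>inverse z ^ (r * i)\<close> vanishes unless \<open>i = 0\<close>. Up to the factor \<open>n\<close> the
  \<open>e r\<close> are the projections to the eigenspaces, so one of them does not annihilate \<open>v\<close>.
\<close>

lemma eigenvector:
  fixes z :: 'k and y :: "('g, 'k) free_algebra"
  assumes z: "primitive_root_of_unity n z" and n: "of_nat n \<noteq> (0 :: 'k)"
    and K: "subspace K" and yK: "\<And>x. x \<in> K \<Longrightarrow> y \<triangleright> x \<in> K"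
    and yn: "\<And>x. x \<in> K \<Longrightarrow> (y ^ n) \<triangleright> x = x" and v: "v \<in> K" "v \<noteq> \<zero>"
  shows "\<exists>r<n. \<exists>w\<in>K. w \<noteq> \<zero> \<and> y \<triangleright> w = fconst (z ^ r) \<triangleright> w"
proof -
  define e where "e r = (\<Sum>i<n. fconst (inverse z ^ (r * i)) * y ^ i)" for r
  have z1: "z ^ n = 1" "n > 0" and zm: "\<And>m. 0 < m \<Longrightarrow> m < n \<Longrightarrow> z ^ m \<noteq> 1"
    using z by (auto simp: primitive_root_of_unity_def)
  have z0: "z \<noteq> 0" using z1 by (auto simp: zero_power)
  have vC: "v \<in> carrier M" using K v by (auto simp: subspace_def)
  have ye: "y * e r = fconst (z ^ r) * (e r + (y ^ n - 1))" for r
  proof -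
    let ?f = "\<lambda>i. fconst (inverse z ^ (r * i)) * y ^ i"
    have "y * e r = (\<Sum>i<n. fconst (z ^ r) * ?f (Suc i))"
      unfolding e_def sum_distrib_left
    proof (rule sum.cong[OF refl])
      fix i
      have "y * ?f i = fconst (inverse z ^ (r * i)) * y ^ Suc i"
        by (simp add: mult.assoc[symmetric] fconst_commute[of y])
      moreover have "inverse z ^ (r * i) = z ^ r * inverse z ^ (r * Suc i)"
        using z0 by (simp add: power_add field_simps)
      ultimately show "y * ?f i = fconst (z ^ r) * ?f (Suc i)"
        by (simp add: fconst_simps mult.assoc)
    qed
    also have "\<dots> = fconst (z ^ r) * (\<Sum>i<n. ?f (Suc i))"
      by (rule sum_distrib_left[symmetric])
    also have "(\<Sum>i<n. ?f (Suc i)) = e r + ?f n - ?f 0"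
      using sum.lessThan_Suc_shift[of ?f n] unfolding e_def by (simp add: algebra_simps)
    also have "inverse z ^ (r * n) = 1"
      using z1 by (simp add: power_mult mult.commute[of r] power_inverse)
    finally show ?thesis by (simp add: fconst_simps add_diff_eq)
  qed
  have sum_e: "(\<Sum>r<n. e r) = fconst (of_nat n)"
  proof -
    have c: "(\<Sum>r<n. inverse z ^ (r * i)) = (if i = 0 then of_nat n else 0)" if "i < n" for i
    proof (cases "i = 0")
      case False
      have "inverse z ^ i \<noteq> 1" using zm[of i] False that by (simp add: power_inverse)
      moreover have "(inverse z ^ i) ^ n = 1"
        using z1 by (simp add: power_mult[symmetric] mult.commute[of i] power_inverse)
          (simp add: power_mult)
      ultimately show ?thesis
        using False sum_gp_strict[of "inverse z ^ i" n]
        by (simp add: power_mult[symmetric] mult.commute)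
    qed simp
    have fs: "fconst (sum g A) = (\<Sum>i\<in>A. fconst (g i))" if "finite A" for g :: "nat \<Rightarrow> 'k" and A
      using that by (induction A rule: finite_induct) (simp_all add: fconst_simps)
    have "(\<Sum>r<n. e r) = (\<Sum>i<n. fconst (\<Sum>r<n. inverse z ^ (r * i)) * y ^ i)"
      unfolding e_def by (subst sum.swap) (simp add: fs sum_distrib_right)
    also have "\<dots> = (\<Sum>i<n. if i = 0 then fconst (of_nat n) else 0)"
      by (rule sum.cong[OF refl]) (simp add: c fconst_simps)
    also have "\<dots> = fconst (of_nat n)" using z1(2) by simp
    finally show ?thesis .
  qed
  have eK: "e r \<triangleright> v \<in> K" for r
  proof -
    have yi: "(y ^ i) \<triangleright> v \<in> K" for i
      using v(1) vC by (induction i) (auto simp: act_mult yK)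
    show ?thesis
      unfolding e_def by (rule act_sum) (use K yi vC in \<open>auto simp: subspace_def act_mult\<close>)
  qed
  have "\<exists>r<n. e r \<triangleright> v \<noteq> \<zero>"
  proof (rule ccontr)
    assume "\<not> (\<exists>r<n. e r \<triangleright> v \<noteq> \<zero>)"
    then have "(\<Sum>r<n. e r) \<triangleright> v \<in> {\<zero>}"
      by (intro act_sum) (auto simp: vC)
    then show False using act_fconst_eq_zero[OF vC n] v(2) sum_e by simp
  qed
  then obtain r where r: "r < n" "e r \<triangleright> v \<noteq> \<zero>" by blast
  have "y \<triangleright> e r \<triangleright> v = fconst (z ^ r) \<triangleright> (e r \<triangleright> v \<oplus> (y ^ n \<triangleright> v \<ominus> v))"
    using ye[of r] vC by (metis act_1 act_add_left act_diff act_mult)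
  also have "\<dots> = fconst (z ^ r) \<triangleright> e r \<triangleright> v"
    using yn[OF v(1)] vC by (simp add: r_neg minus_eq)
  finally show ?thesis using r eK[of r] by blast
qed

text \<open>
  Compatibility with scalars and generators suffices, by induction over the free algebra.
\<close>

lemma module_hom_matrix_module:
  assumes "satisfies_relations \<rho> Rel"
    and closed: "\<And>u. \<phi> u \<in> carrier M" and add: "\<And>u v. \<phi> (u + v) = \<phi> u \<oplus> \<phi> v"
    and scal: "\<And>c u. \<phi> (c *s u) = fconst c \<triangleright> \<phi> u" and gen: "\<And>y u. \<phi> (\<rho> y *v u) = fgen y \<triangleright> \<phi> u"
  shows "module_hom (presented_algebra Rel) (matrix_module \<rho>) M \<phi>"
proof -
  have "\<phi> (free_action \<rho> p u) = p \<triangleright> \<phi> u" for p u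
    by (induction p arbitrary: u rule: free_algebra_induct)
       (simp_all add: scal gen free_action_add free_action_mult act_add_left act_mult closed add)
  then show ?thesis
    by (auto simp: module_hom_def residue_class_ball closed add smult_matrix_module[OF assms(1)]
        act_def)
qed

end

section \<open>Scalar and two-by-two matrices\<close>

lemma mat_mult_vec: "mat c *v v = c *s (v :: 'k::field^'n)"
  by (simp add: vec_eq_iff matrix_vector_mult_def mat_def if_distrib[of "\<lambda>x. x * _"] sum.delta
      cong: if_cong)

lemma mat22_mult_vec: "mat22 p q r t *v v = vector [p * v$1 + q * v$2, r * v$1 + t * v$2]"
  by (simp add: vec_eq_iff forall_2 matrix_vector_mult_def mat22_def sum_2)

lemma free_action_power_diagonal:
  assumes "\<rho> y = mat22 p 0 0 q"
  shows "free_action \<rho> (fgen y ^ n) v = vector [p ^ n * v$1, q ^ n * v$2]"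
  by (induction n) (simp_all add: free_action_mult assms mat22_mult_vec mult.assoc vec_eq_iff forall_2)

section \<open>Roots of unity\<close>

lemma primitive_root_power_eq_iff:
  fixes z :: "'k::field"
  assumes "primitive_root_of_unity n z"
  shows "z ^ l = z ^ m \<longleftrightarrow> [l = m] (mod n)"
proof -
  have z: "z ^ n = 1" "n > 0" and pr: "\<And>m. 0 < m \<Longrightarrow> m < n \<Longrightarrow> z ^ m \<noteq> 1"
    using assms by (auto simp: primitive_root_of_unity_def)
  have z0: "z \<noteq> 0" using z by (auto simp: zero_power)
  have red: "z ^ l = z ^ (l mod n)" for l
  proof -
    have "z ^ l = z ^ (n * (l div n) + l mod n)" by simp
    also have "\<dots> = z ^ (l mod n)" unfolding power_add power_mult z(1) by simp
    finally show ?thesis .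
  qed
  have le: "l = m" if "l \<le> m" "m < n" "z ^ l = z ^ m" for l m
  proof (rule ccontr)
    assume "l \<noteq> m"
    moreover have "z ^ (m - l) = 1" using that z0 by (simp add: power_diff)
    ultimately show False using pr[of "m - l"] that by auto
  qed
  have "l mod n = m mod n" if "z ^ (l mod n) = z ^ (m mod n)"
    using le[of "l mod n" "m mod n"] le[of "m mod n" "l mod n"] that z(2)
    by (metis mod_less_divisor nat_le_linear)
  then show ?thesis using red[of l] red[of m] by (auto simp: cong_def)
qed

lemma sign_cases:
  fixes x :: "'k::field"
  assumes "x ^ 2 = 1"
  obtains k where "k \<in> {0, 1::nat}" "x = (- 1) ^ k"
proof -
  have "x = 1 \<or> x = -1" using assms by (simp add: power2_eq_1_iff)
  then show ?thesis using that[of 0] that[of 1] by auto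
qed

lemma sign_eq_iff:
  fixes k l :: nat
  assumes "(- 1 :: 'k::field_char_0) ^ k = (- 1) ^ l" "k \<in> {0, 1}" "l \<in> {0, 1}"
  shows "k = l"
  using assms by auto

locale double_data =
  fixes \<xi> s :: "'k::field_char_0"
  assumes prim: "primitive_root_of_unity 6 \<xi>" and s2: "s ^ 2 = 1 - \<xi> ^ 2"
begin

lemma \<xi>6: "\<xi> ^ 6 = 1" and \<xi>_nz [simp]: "\<xi> \<noteq> 0"
  using prim by (auto simp: primitive_root_of_unity_def)

lemma \<xi>3: "\<xi> ^ 3 = - 1"
proof -
  have "\<xi> ^ 3 \<noteq> 1" using prim by (auto simp: primitive_root_of_unity_def)
  moreover have "(\<xi> ^ 3) ^ 2 = 1" using \<xi>6 by (simp flip: power_mult)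
  ultimately show ?thesis by (metis power2_eq_1_iff)
qed

lemma s_nz [simp]: "s \<noteq> 0"
proof -
  have "\<xi> ^ 2 \<noteq> 1" using prim by (auto simp: primitive_root_of_unity_def)
  then show ?thesis using s2 by auto
qed

text \<open>
  The powers of \<open>\<xi>\<close> are six roots of \<open>x ^ 6 - 1\<close>; since \<open>\<xi>\<close> satisfies the cyclotomic equation
  \<open>\<xi> ^ 2 - \<xi> + 1 = 0\<close>, the product of the six linear factors expands to this polynomial.
\<close>

lemma sixth_root_cases:
  assumes "x ^ 6 = (1 :: 'k)"
  obtains r where "r \<in> {0..5::nat}" "x = \<xi> ^ r"
proof -
  have "(x ^ 3) ^ 2 = 1" using assms by (simp flip: power_mult)
  moreover have q: "\<xi> * \<xi> = \<xi> - 1"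
  proof -
    have "(\<xi> + 1) * (\<xi> ^ 2 - \<xi> + 1) = 0"
      using \<xi>3 by (simp add: algebra_simps power2_eq_square power3_eq_cube)
    moreover have "\<xi> ^ 2 \<noteq> 1" using prim by (auto simp: primitive_root_of_unity_def)
    then have "\<xi> + 1 \<noteq> 0" by (auto simp: add_eq_0_iff2)
    ultimately have "\<xi> ^ 2 - \<xi> + 1 = 0" by simp
    then show ?thesis by (simp add: power2_eq_square algebra_simps)
  qed
  ultimately have "(x - 1) * (x - \<xi>) * (x - \<xi> ^ 2) * (x - \<xi> ^ 3) * (x - \<xi> ^ 4) * (x - \<xi> ^ 5) = 0"
    by Groebner_Basis.algebra
  then have "x = \<xi> ^ 0 \<or> x = \<xi> ^ 1 \<or> x = \<xi> ^ 2 \<or> x = \<xi> ^ 3 \<or> x = \<xi> ^ 4 \<or> x = \<xi> ^ 5"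
    by auto
  then show ?thesis
    using that[of 0] that[of 1] that[of 2] that[of 3] that[of 4] that[of 5] by auto
qed

section \<open>The two families of modules\<close>

abbreviation "\<D> \<equiv> double_relations \<xi> s"

lemma double_eq: "double \<xi> s = presented_algebra \<D>"
  by (simp add: double_def)

lemma power_powi: "\<xi> powi (int i - 1) = \<xi> ^ i / \<xi>" "\<xi> powi (1 - int i) = \<xi> / \<xi> ^ i"
  by (simp_all add: power_int_diff)

lemma chi_satisfies: "satisfies_relations (\<lambda>y. mat (chi \<xi> i j k y) :: 'k^1^1) \<D>"
proof -
  define A where "A = \<xi> ^ k"
  define G :: 'k where "G = (- 1) ^ i"
  define H :: 'k where "H = (- 1) ^ j"
  have A6: "A ^ 6 = 1" unfolding A_def using \<xi>6 by (metis mult.commute power_mult power_one)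
  have GH: "G * G = 1" "H * H = 1" "G \<noteq> 0" "H \<noteq> 0"
    by (simp_all add: G_def H_def flip: power_mult_distrib)
  have GH': "G * (G * x) = x" "H * (H * x) = x" for x
    using GH by (simp_all flip: mult.assoc)
  show ?thesis
    unfolding satisfies_relations_def double_relations_def K24_relations_def Let_def
    using GH A6
    by (simp add: free_action_mult free_action_add free_action_diff free_action_uminus
        eval_nat_numeral mat_mult_vec vec_eq_iff
        flip: A_def G_def H_def) (simp add: GH' algebra_simps)
qed

text \<open>
  In terms of the eigenvalues \<open>D\<close>, \<open>G\<close>, \<open>H\<close> of \<open>d\<close>, \<open>g\<close>, \<open>h\<close> on the first basis vector and the sign
  \<open>e\<close>, all relations become polynomial identities modulo \<open>e ^ 2 = 1\<close>, \<open>H ^ 2 = 1\<close> and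
  \<open>s ^ 2 = 1 - \<xi> ^ 2\<close>.
\<close>

lemma V_matrix_satisfies: "satisfies_relations (V_matrix \<xi> s i j k \<iota>) \<D>"
proof -
  define D where "D = \<xi> ^ i"
  define G where "G = \<xi> ^ j"
  define H :: 'k where "H = (- 1) ^ k"
  define e :: 'k where "e = (- 1) ^ \<iota>"
  have six: "(\<xi> ^ m) ^ 6 = 1" for m
    using \<xi>6 by (metis mult.commute power_mult power_one)
  have e: "e * e = 1" "H * H = 1" "D \<noteq> 0"
    by (simp_all add: e_def H_def D_def flip: power_mult_distrib)
  have e2: "e ^ 2 = 1" "H ^ 2 = 1" using e by (simp_all add: power2_eq_square)
  then have e6: "e ^ 6 = 1" using power_mult[of e 2 3] by simp
  have pw: "D ^ 6 = 1" "G ^ 6 = 1" "(e * D) ^ 6 = 1" "(D / \<xi>) ^ 6 = 1" "(e * D / \<xi>) ^ 6 = 1"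
    "(e * D) ^ 2 = D ^ 2" "(e * D / \<xi>) ^ 2 = (D / \<xi>) ^ 2"
    using six[of i] six[of j] e2 e6 \<xi>6
    by (simp_all add: power_mult_distrib power_divide flip: D_def G_def)
  have sq: "fgen y ^ 2 = fgen y * (fgen y :: (dgen, 'k) free_algebra)" for y
    by (rule power2_eq_square)
  show ?thesis
    unfolding satisfies_relations_def double_relations_def K24_relations_def Let_def
    using e(3)
    by (simp add: free_action_mult free_action_add free_action_diff free_action_uminus
        free_action_power_diagonal mat22_mult_vec vec_eq_iff forall_2 power_powi
        sq[of Gen_x] sq[of Gen_b] sq[of Gen_c] e2 pw
        flip: D_def G_def H_def e_def)
      (intro conjI allI; (simp add: divide_simps)?;
        ((simp add: algebra_simps; fail) | (use e s2 in Groebner_Basis.algebra))?)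
qed

lemma simple_k_chi: "simple_left_module (double \<xi> s) (k_chi \<xi> i j k)"
  unfolding double_eq k_chi_def
proof (rule simple_matrix_module[OF chi_satisfies])
  fix v u :: "'k^1" assume "v \<noteq> 0"
  then have "v$1 \<noteq> 0" by (simp add: vec_eq_iff forall_1)
  then show "\<exists>p. free_action (\<lambda>y. mat (chi \<xi> i j k y)) p v = u"
    by (intro exI[of _ "fconst (u$1 / v$1)"]) (simp add: vec_eq_iff forall_1)
qed

text \<open>
  The coefficient of the second basis vector in the image of the first one under \<open>x\<close>.
\<close>

definition kappa :: "nat \<Rightarrow> nat \<Rightarrow> nat \<Rightarrow> nat \<Rightarrow> 'k" where
  "kappa i j k \<iota> = - s * (\<xi> ^ i / \<xi>) * (\<xi> ^ j * (- 1) ^ k + (- 1) ^ \<iota>)"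

lemma kappa_nonzero_iff:
  "kappa i j k \<iota> \<noteq> 0 \<longleftrightarrow> \<not> [j + 3 * k = 3 * (\<iota> + 1)] (mod 6)"
proof -
  have "[j + 3 * k = 3 * (\<iota> + 1)] (mod 6) \<longleftrightarrow> \<xi> ^ (j + 3 * k) = \<xi> ^ (3 * (\<iota> + 1))"
    by (rule primitive_root_power_eq_iff[OF prim, symmetric])
  also have "\<dots> \<longleftrightarrow> \<xi> ^ j * (- 1) ^ k = - ((- 1) ^ \<iota>)"
    unfolding power_add power_mult \<xi>3 by simp
  also have "\<dots> \<longleftrightarrow> kappa i j k \<iota> = 0"
    by (simp add: kappa_def add_eq_0_iff2)
  finally show ?thesis by blast
qed

text \<open>
  A vector with nonzero second coordinate is sent by \<open>c\<close> to a nonzero multiple of the first basis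
  vector, and \<open>x\<close> sends the first basis vector to \<open>\<kappa>\<close> times the second one.
\<close>

lemma simple_V_module:
  assumes "kappa i j k \<iota> \<noteq> 0"
  shows "simple_left_module (double \<xi> s) (V_module \<xi> s i j k \<iota>)"
  unfolding double_eq V_module_def
proof (rule simple_matrix_module[OF V_matrix_satisfies])
  fix v u :: "'k^2" assume v: "v \<noteq> 0"
  let ?F = "free_action (V_matrix \<xi> s i j k \<iota>)"
  have x: "V_matrix \<xi> s i j k \<iota> Gen_x *v vector [p, 0] = vector [0, kappa i j k \<iota> * p]" for p
    by (simp add: mat22_mult_vec vec_eq_iff forall_2 kappa_def power_powi)
  have e1: "\<exists>p. ?F p (vector [q, 0]) = u" if "q \<noteq> 0" for q
    by (intro exI[of _ "fconst (u$1 / q) + fconst (u$2 / (kappa i j k \<iota> * q)) * fgen Gen_x"])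
       (simp del: V_matrix.simps add: free_action_add free_action_mult x vec_eq_iff forall_2 that assms)
  show "\<exists>p. ?F p v = u"
  proof (cases "v$2 = 0")
    case True
    then have "v = vector [v$1, 0]" "v$1 \<noteq> 0" using v by (auto simp: vec_eq_iff forall_2)
    then show ?thesis using e1[of "v$1"] by metis
  next
    case False
    have "?F (fgen Gen_c) v = vector [v$2, 0]"
      by (simp add: mat22_mult_vec)
    then show ?thesis using e1[OF False] by (metis free_action_mult)
  qed
qed

text \<open>
  An isomorphism intertwines the generators, which act as scalars; so the scalars agree.
\<close>

lemma k_chi_iso_eq:
  assumes idx: "(i, j, k) \<in> chi_index" "(i', j', k') \<in> chi_index"
    and iso: "module_iso (double \<xi> s) (k_chi \<xi> i j k) (k_chi \<xi> i' j' k')"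
  shows "(i, j, k) = (i', j', k')"
proof -
  obtain f :: "'k^1 \<Rightarrow> 'k^1" where f: "bij f" "f 0 = 0" "\<And>c v. f (c *s v) = c *s f v"
    "\<And>y v. f (mat (chi \<xi> i j k y) *v v) = mat (chi \<xi> i' j' k' y) *v f v"
    using iso unfolding double_eq k_chi_def
    by (rule module_iso_matrix_moduleE[OF chi_satisfies chi_satisfies]) (rule that)
  have "vec 1 \<noteq> (0 :: 'k^1)" by (simp add: vec_eq_iff)
  then have "f (vec 1) \<noteq> f 0" using inj_eq[OF bij_is_inj[OF f(1)]] by blast
  then have nz: "f (vec 1) $ 1 \<noteq> 0" by (simp add: f(2) vec_eq_iff forall_1)
  have eq: "chi \<xi> i j k y = chi \<xi> i' j' k' y" for y
    using f(4)[of y "vec 1"] nz by (simp add: mat_mult_vec f(3) vec_eq_iff forall_1)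
  have "k = k'"
    using eq[of Gen_a] primitive_root_power_eq_iff[OF prim] idx by (simp add: chi_index_def cong_def)
  moreover have "i = i'"
    by (rule sign_eq_iff[where ?'k = 'k]) (use eq[of Gen_g] idx in \<open>simp_all add: chi_index_def\<close>)
  moreover have "j = j'"
    by (rule sign_eq_iff[where ?'k = 'k]) (use eq[of Gen_h] idx in \<open>simp_all add: chi_index_def\<close>)
  ultimately show ?thesis by simp
qed

text \<open>
  The kernel of \<open>c\<close> is the line of the first basis vector in both modules. An isomorphism maps
  one of these lines to the other, so \<open>d\<close>, \<open>g\<close>, \<open>h\<close>, \<open>a\<close> have the same eigenvalues on them, and
  these determine the four indices in turn.
\<close>

lemma V_module_iso_eq:
  assumes idx: "(i, j, k, \<iota>) \<in> Lambda" "(i', j', k', \<iota>') \<in> Lambda"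
    and iso: "module_iso (double \<xi> s) (V_module \<xi> s i j k \<iota>) (V_module \<xi> s i' j' k' \<iota>')"
  shows "(i, j, k, \<iota>) = (i', j', k', \<iota>')"
proof -
  let ?W = "V_matrix \<xi> s i j k \<iota>" and ?W' = "V_matrix \<xi> s i' j' k' \<iota>'"
  obtain f :: "'k^2 \<Rightarrow> 'k^2" where f: "bij f" "f 0 = 0" "\<And>c v. f (c *s v) = c *s f v"
    "\<And>y v. f (?W y *v v) = ?W' y *v f v"
    using iso unfolding double_eq V_module_def
    by (rule module_iso_matrix_moduleE[OF V_matrix_satisfies V_matrix_satisfies]) (rule that)
  define e1 :: "'k^2" where "e1 = vector [1, 0]"
  have e1: "e1 $ 1 = 1" "e1 $ 2 = 0" by (simp_all add: e1_def)
  then have "e1 \<noteq> 0" by auto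
  then have "f e1 \<noteq> f 0" using inj_eq[OF bij_is_inj[OF f(1)]] by blast
  moreover have 2: "f e1 $ 2 = 0"
  proof -
    have "?W Gen_c *v e1 = 0" by (simp add: mat22_mult_vec vec_eq_iff forall_2 e1_def)
    then have "?W' Gen_c *v f e1 = 0" using f(4)[of Gen_c e1] f(2) by metis
    then show ?thesis by (simp add: mat22_mult_vec vec_eq_iff forall_2)
  qed
  ultimately have nz: "f e1 $ 1 \<noteq> 0" by (auto simp add: f(2) vec_eq_iff forall_2)
  have eq: "c = c'" if "?W y *v e1 = c *s e1" "?W' y *v f e1 = c' *s f e1" for y c c'
  proof -
    have "c *s f e1 = c' *s f e1" using f(3)[of c e1] f(4)[of y e1] that by metis
    then show ?thesis using nz by (metis mult_cancel_right vector_smult_component)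
  qed
  have d: "\<xi> ^ i = \<xi> ^ i'"
    by (rule eq[of Gen_d]) (simp_all add: mat22_mult_vec vec_eq_iff forall_2 2 e1)
  have g: "\<xi> ^ j = \<xi> ^ j'"
    by (rule eq[of Gen_g]) (simp_all add: mat22_mult_vec vec_eq_iff forall_2 2 e1)
  have h: "(- 1) ^ k = (- 1 :: 'k) ^ k'"
    by (rule eq[of Gen_h]) (simp_all add: mat22_mult_vec vec_eq_iff forall_2 2 e1)
  have a: "(- 1) ^ (\<iota> + 1) * \<xi> ^ i = (- 1) ^ (\<iota>' + 1) * \<xi> ^ i'"
    by (rule eq[of Gen_a]) (simp_all add: mat22_mult_vec vec_eq_iff forall_2 2 e1)
  then have "(- 1) ^ \<iota> = (- 1 :: 'k) ^ \<iota>'" using d by simp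
  then have "\<iota> = \<iota>'"
    by (rule sign_eq_iff) (use idx in \<open>simp_all add: Lambda_def\<close>)
  moreover have "k = k'"
    by (rule sign_eq_iff[OF h]) (use idx in \<open>simp_all add: Lambda_def\<close>)
  moreover have "i = i'" "j = j'"
    using d g idx primitive_root_power_eq_iff[OF prim] by (simp_all add: Lambda_def cong_def)
  ultimately show ?thesis by simp
qed

text \<open>
  The generator \<open>c\<close> acts as zero on the one side but not on the other.
\<close>

lemma k_chi_not_iso_V: "\<not> module_iso (double \<xi> s) (k_chi \<xi> i j k) (V_module \<xi> s i' j' k' \<iota>')"
proof
  let ?W' = "V_matrix \<xi> s i' j' k' \<iota>'"
  assume "module_iso (double \<xi> s) (k_chi \<xi> i j k) (V_module \<xi> s i' j' k' \<iota>')"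
  then obtain f :: "'k^1 \<Rightarrow> 'k^2" where f: "bij f" "f 0 = 0" "\<And>c v. f (c *s v) = c *s f v"
    "\<And>y v. f (mat (chi \<xi> i j k y) *v v) = ?W' y *v f v"
    unfolding double_eq V_module_def k_chi_def
    by (rule module_iso_matrix_moduleE[OF chi_satisfies V_matrix_satisfies]) (rule that)
  obtain u where u: "f u = vector [0, 1]" using f(1) by (metis bij_pointE)
  have "?W' Gen_c *v f u = 0"
    using f(4)[of Gen_c u] f(2) by (simp add: mat_mult_vec)
  then show False by (simp add: u mat22_mult_vec vec_eq_iff forall_2)
qed

end

section \<open>Classification of the simple modules\<close>

locale double_module = double_data \<xi> s + presented_module "double_relations \<xi> s" M
  for \<xi> s :: "'k::field_char_0" and M :: "('k double_elem, 'm) module" (structure)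
begin

notation act (infixr \<open>\<triangleright>\<close> 75)

abbreviation "\<g> \<equiv> fgen Gen_g :: (dgen, 'k) free_algebra"
abbreviation "\<h> \<equiv> fgen Gen_h :: (dgen, 'k) free_algebra"
abbreviation "\<x> \<equiv> fgen Gen_x :: (dgen, 'k) free_algebra"
abbreviation "\<a> \<equiv> fgen Gen_a :: (dgen, 'k) free_algebra"
abbreviation "\<b> \<equiv> fgen Gen_b :: (dgen, 'k) free_algebra"
abbreviation "\<c> \<equiv> fgen Gen_c :: (dgen, 'k) free_algebra"
abbreviation "\<d> \<equiv> fgen Gen_d :: (dgen, 'k) free_algebra"

text \<open>
  For use as the only rules of the simplifier: a pair is recognised among the relations by
  reflexivity, before any rewriting of the ring elements that it consists of.
\<close>

lemmas relation_membership =
  double_relations_def K24_relations_def Let_def Un_iff insert_iff simp_thms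

lemma K24_act:
  "(\<a> ^ 6) \<triangleright> v = 1 \<triangleright> v" "(\<b> ^ 2) \<triangleright> v = 0 \<triangleright> v" "(\<c> ^ 2) \<triangleright> v = 0 \<triangleright> v" "(\<d> ^ 6) \<triangleright> v = 1 \<triangleright> v"
  "(\<a> ^ 2) \<triangleright> v = (\<d> ^ 2) \<triangleright> v" "(\<a> * \<d>) \<triangleright> v = (\<d> * \<a>) \<triangleright> v"
  "(\<b> * \<c>) \<triangleright> v = 0 \<triangleright> v" "(\<c> * \<b>) \<triangleright> v = 0 \<triangleright> v"
  "(\<a> * \<b>) \<triangleright> v = (fconst \<xi> * \<b> * \<a>) \<triangleright> v" "(\<a> * \<c>) \<triangleright> v = (fconst \<xi> * \<c> * \<a>) \<triangleright> v"
  "(\<d> * \<b>) \<triangleright> v = (- fconst \<xi> * \<b> * \<d>) \<triangleright> v" "(\<d> * \<c>) \<triangleright> v = (- fconst \<xi> * \<c> * \<d>) \<triangleright> v"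
  by (rule act_relation, simp only: relation_membership)+

lemma group_act:
  "(\<g> ^ 6) \<triangleright> v = 1 \<triangleright> v" "(\<h> ^ 2) \<triangleright> v = 1 \<triangleright> v" "(\<g> * \<h>) \<triangleright> v = (\<h> * \<g>) \<triangleright> v"
  "(\<a> * \<g>) \<triangleright> v = (\<g> * \<a>) \<triangleright> v" "(\<a> * \<h>) \<triangleright> v = (\<h> * \<a>) \<triangleright> v"
  "(\<d> * \<g>) \<triangleright> v = (\<g> * \<d>) \<triangleright> v" "(\<d> * \<h>) \<triangleright> v = (\<h> * \<d>) \<triangleright> v"
  "(\<b> * \<g>) \<triangleright> v = (\<g> * \<b>) \<triangleright> v" "(\<b> * \<h>) \<triangleright> v = (- \<h> * \<b>) \<triangleright> v"
  "(\<c> * \<g>) \<triangleright> v = (\<g> * \<c>) \<triangleright> v" "(\<c> * \<h>) \<triangleright> v = (- \<h> * \<c>) \<triangleright> v"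
  by (rule act_relation, simp only: relation_membership)+

lemma x_act:
  "(\<g> * \<x>) \<triangleright> v = (\<x> * \<g>) \<triangleright> v" "(\<h> * \<x>) \<triangleright> v = (- \<x> * \<h>) \<triangleright> v" "(\<x> ^ 2) \<triangleright> v = (1 - \<g> ^ 2) \<triangleright> v"
  by (rule act_relation, simp only: relation_membership)+

lemma x_K24_act:
  defines "q \<equiv> fconst (inverse \<xi>)" and "t \<equiv> fconst (- s * inverse \<xi>)"
  shows "(\<a> * \<x> - q * \<x> * \<a>) \<triangleright> v = (t * (\<c> - \<g> * \<h> * \<b>)) \<triangleright> v"
    "(\<d> * \<x> + q * \<x> * \<d>) \<triangleright> v = (t * (\<g> * \<h> * \<c> - \<b>)) \<triangleright> v"
    "(\<b> * \<x> - q * \<x> * \<b>) \<triangleright> v = (t * (\<d> - \<g> * \<h> * \<a>)) \<triangleright> v"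
    "(\<c> * \<x> + q * \<x> * \<c>) \<triangleright> v = (t * (\<g> * \<h> * \<d> - \<a>)) \<triangleright> v"
  unfolding q_def t_def by (rule act_relation, simp only: relation_membership)+

text \<open>
  A weight vector plays the part of the first basis vector of \<open>V\<close> and of the generator of the
  one-dimensional modules.
\<close>

definition weight_vector :: "'k \<Rightarrow> 'k \<Rightarrow> 'k \<Rightarrow> 'k \<Rightarrow> 'm \<Rightarrow> bool" where
  "weight_vector \<gamma> \<eta> \<alpha> \<delta> v \<longleftrightarrow> v \<in> carrier M \<and> v \<noteq> \<zero> \<and> \<b> \<triangleright> v = \<zero> \<and> \<c> \<triangleright> v = \<zero> \<and>
     \<g> \<triangleright> v = fconst \<gamma> \<triangleright> v \<and> \<h> \<triangleright> v = fconst \<eta> \<triangleright> v \<and> \<a> \<triangleright> v = fconst \<alpha> \<triangleright> v \<and> \<d> \<triangleright> v = fconst \<delta> \<triangleright> v"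

lemma weight_power:
  assumes "v \<in> carrier M" "p \<triangleright> v = fconst c \<triangleright> v"
  shows "(p ^ n) \<triangleright> v = fconst (c ^ n) \<triangleright> v"
proof (induction n)
  case 0
  then show ?case by (simp add: fconst_simps)
next
  case (Suc n)
  have "(p ^ Suc n) \<triangleright> v = p \<triangleright> fconst (c ^ n) \<triangleright> v"
    using Suc assms(1) by (simp add: act_mult)
  also have "\<dots> = fconst (c ^ n) \<triangleright> fconst c \<triangleright> v"
    by (simp only: act_fconst_commute[OF assms(1), of p] assms(2))
  finally show ?case using assms(1) by (simp add: act_fconst_fconst mult.commute)
qed

lemma weight_relations:
  assumes "weight_vector \<gamma> \<eta> \<alpha> \<delta> v"
  shows "\<gamma> ^ 6 = 1" "\<eta> ^ 2 = 1" "\<alpha> ^ 6 = 1" "\<delta> ^ 6 = 1" "\<alpha> ^ 2 = \<delta> ^ 2"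
proof -
  have v: "v \<in> carrier M" "v \<noteq> \<zero>" using assms by (auto simp: weight_vector_def)
  have pow: "(\<g> ^ n) \<triangleright> v = fconst (\<gamma> ^ n) \<triangleright> v" "(\<h> ^ n) \<triangleright> v = fconst (\<eta> ^ n) \<triangleright> v"
    "(\<a> ^ n) \<triangleright> v = fconst (\<alpha> ^ n) \<triangleright> v" "(\<d> ^ n) \<triangleright> v = fconst (\<delta> ^ n) \<triangleright> v" for n
    using assms by (auto simp: weight_vector_def intro!: weight_power)
  have one: "1 \<triangleright> v = fconst 1 \<triangleright> v" by (simp add: fconst_simps)
  show "\<gamma> ^ 6 = 1" "\<eta> ^ 2 = 1" "\<alpha> ^ 6 = 1" "\<delta> ^ 6 = 1" "\<alpha> ^ 2 = \<delta> ^ 2"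
    by (rule act_fconst_cancel[OF v]; metis pow one K24_act(1,4,5) group_act(1,2))+
qed

text \<open>
  The common kernel of \<open>b\<close> and \<open>c\<close> contains \<open>b u\<close> and \<open>c u\<close> for every \<open>u\<close>, and \<open>u\<close> itself if both of
  these vanish; so it is nonzero. Inside it, eigenspaces of \<open>g\<close>, \<open>h\<close>, \<open>a\<close>, \<open>d\<close> are taken one after the other; each is stable under the
  remaining operators because they commute.
\<close>

lemma weight_vector_exists:
  assumes "carrier M \<noteq> {\<zero>}"
  obtains \<gamma> \<eta> \<alpha> \<delta> v where "weight_vector \<gamma> \<eta> \<alpha> \<delta> v"
proof -
  define K where "K = {v \<in> carrier M. \<b> \<triangleright> v = \<zero> \<and> \<c> \<triangleright> v = \<zero>}"
  obtain u where u: "u \<in> carrier M" "u \<noteq> \<zero>" using assms zero_closed by blast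
  have "\<exists>v\<in>K. v \<noteq> \<zero>"
  proof (cases "\<b> \<triangleright> u = \<zero> \<and> \<c> \<triangleright> u = \<zero>")
    case False
    have "\<b> \<triangleright> u \<in> K" "\<c> \<triangleright> u \<in> K"
      using u(1) K24_act(2,3,7,8)[of u] by (simp_all add: K_def act_mult power2_eq_square)
    then show ?thesis using False by blast
  qed (use u in \<open>auto simp: K_def\<close>)
  then obtain v0 where v0: "v0 \<in> K" "v0 \<noteq> \<zero>" by blast
  have KC: "x \<in> carrier M" if "x \<in> K" for x using that by (simp add: K_def)
  have sub: "subspace K"
    unfolding subspace_def K_def by (auto simp: act_add act_gen_fconst)
  \<comment> \<open>From \<open>a b = \<xi> b a\<close> and \<open>b u = 0\<close> one gets \<open>\<xi> b (a u) = 0\<close>; likewise for the other pairs.\<close>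
  have K_stable: "\<g> \<triangleright> x \<in> K" "\<h> \<triangleright> x \<in> K" "\<a> \<triangleright> x \<in> K" "\<d> \<triangleright> x \<in> K" if x: "x \<in> K" for x
  proof -
    have xK: "x \<in> carrier M" "\<b> \<triangleright> x = \<zero>" "\<c> \<triangleright> x = \<zero>" using x by (auto simp: K_def)
    show "\<g> \<triangleright> x \<in> K" "\<h> \<triangleright> x \<in> K"
      using group_act(8-11)[of x] xK by (simp_all add: K_def act_normalize)
    have "fconst \<xi> \<triangleright> \<b> \<triangleright> \<a> \<triangleright> x = \<a> \<triangleright> \<b> \<triangleright> x" "fconst \<xi> \<triangleright> \<c> \<triangleright> \<a> \<triangleright> x = \<a> \<triangleright> \<c> \<triangleright> x"
      "fconst (- \<xi>) \<triangleright> \<b> \<triangleright> \<d> \<triangleright> x = \<d> \<triangleright> \<b> \<triangleright> x" "fconst (- \<xi>) \<triangleright> \<c> \<triangleright> \<d> \<triangleright> x = \<d> \<triangleright> \<c> \<triangleright> x"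
      using K24_act(9-12)[of x] xK(1) by (simp_all add: act_normalize)
    then show "\<a> \<triangleright> x \<in> K" "\<d> \<triangleright> x \<in> K"
      using xK act_fconst_eq_zero[of "\<b> \<triangleright> \<a> \<triangleright> x" \<xi>] act_fconst_eq_zero[of "\<c> \<triangleright> \<a> \<triangleright> x" \<xi>]
        act_fconst_eq_zero[of "\<b> \<triangleright> \<d> \<triangleright> x" "- \<xi>"] act_fconst_eq_zero[of "\<c> \<triangleright> \<d> \<triangleright> x" "- \<xi>"]
      by (simp_all add: K_def)
  qed
  define Kg where "Kg \<gamma> = {x \<in> K. \<g> \<triangleright> x = fconst \<gamma> \<triangleright> x}" for \<gamma>
  define Kh where "Kh \<gamma> \<eta> = {x \<in> Kg \<gamma>. \<h> \<triangleright> x = fconst \<eta> \<triangleright> x}" for \<gamma> \<eta>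
  define Ka where "Ka \<gamma> \<eta> \<alpha> = {x \<in> Kh \<gamma> \<eta>. \<a> \<triangleright> x = fconst \<alpha> \<triangleright> x}" for \<gamma> \<eta> \<alpha>
  note defs = Kg_def Kh_def Ka_def
  have sub': "subspace (Kg \<gamma>)" "subspace (Kh \<gamma> \<eta>)" "subspace (Ka \<gamma> \<eta> \<alpha>)" for \<gamma> \<eta> \<alpha>
    unfolding defs by (intro subspace_eigenspace sub)+
  have prim2: "primitive_root_of_unity 2 (- 1 :: 'k)"
    by (auto simp: primitive_root_of_unity_def less_2_cases_iff)
  have "\<exists>r<6. \<exists>w\<in>K. w \<noteq> \<zero> \<and> \<g> \<triangleright> w = fconst (\<xi> ^ r) \<triangleright> w"
    by (rule eigenvector[OF prim _ sub _ _ v0]) (use K_stable group_act in \<open>auto simp: KC\<close>)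
  then obtain \<gamma> v1 where v1: "v1 \<in> Kg \<gamma>" "v1 \<noteq> \<zero>" by (auto simp: defs)
  have "\<exists>r<2. \<exists>w\<in>Kg \<gamma>. w \<noteq> \<zero> \<and> \<h> \<triangleright> w = fconst ((- 1) ^ r) \<triangleright> w"
    by (rule eigenvector[OF prim2 _ sub'(1) _ _ v1])
       (use K_stable group_act(2,3) in \<open>auto simp: KC defs intro: eigenspace_stable\<close>)
  then obtain \<eta> v2 where v2: "v2 \<in> Kh \<gamma> \<eta>" "v2 \<noteq> \<zero>" by (auto simp: defs)
  have "\<exists>r<6. \<exists>w\<in>Kh \<gamma> \<eta>. w \<noteq> \<zero> \<and> \<a> \<triangleright> w = fconst (\<xi> ^ r) \<triangleright> w"
    by (rule eigenvector[OF prim _ sub'(2) _ _ v2])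
       (use K_stable group_act(4,5)[symmetric] K24_act(1) in \<open>auto simp: KC defs intro: eigenspace_stable\<close>)
  then obtain \<alpha> v3 where v3: "v3 \<in> Ka \<gamma> \<eta> \<alpha>" "v3 \<noteq> \<zero>" by (auto simp: defs)
  have "\<exists>r<6. \<exists>w\<in>Ka \<gamma> \<eta> \<alpha>. w \<noteq> \<zero> \<and> \<d> \<triangleright> w = fconst (\<xi> ^ r) \<triangleright> w"
    by (rule eigenvector[OF prim _ sub'(3) _ _ v3])
       (use K_stable group_act(6,7)[symmetric] K24_act(4,6) in \<open>auto simp: KC defs intro: eigenspace_stable\<close>)
  then obtain \<delta> w where "w \<in> Ka \<gamma> \<eta> \<alpha>" "w \<noteq> \<zero>" "\<d> \<triangleright> w = fconst \<delta> \<triangleright> w" by blast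
  then have "weight_vector \<gamma> \<eta> \<alpha> \<delta> w" by (auto simp: weight_vector_def defs K_def)
  then show ?thesis by (rule that)
qed

text \<open>
  Each equation is the relation that exchanges \<open>x\<close> with a generator, evaluated at \<open>v\<close>: the terms
  that end in \<open>b\<close> or \<open>c\<close> vanish and the other generators act as scalars.
\<close>

lemma x_weight_vector:
  assumes "weight_vector \<gamma> \<eta> \<alpha> \<delta> v"
  shows "\<g> \<triangleright> \<x> \<triangleright> v = fconst \<gamma> \<triangleright> \<x> \<triangleright> v" "\<h> \<triangleright> \<x> \<triangleright> v = fconst (- \<eta>) \<triangleright> \<x> \<triangleright> v"
    "\<a> \<triangleright> \<x> \<triangleright> v = fconst (\<alpha> / \<xi>) \<triangleright> \<x> \<triangleright> v" "\<d> \<triangleright> \<x> \<triangleright> v = fconst (- \<delta> / \<xi>) \<triangleright> \<x> \<triangleright> v"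
    "\<b> \<triangleright> \<x> \<triangleright> v = fconst (- s / \<xi> * (\<delta> - \<gamma> * \<eta> * \<alpha>)) \<triangleright> v"
    "\<c> \<triangleright> \<x> \<triangleright> v = fconst (- s / \<xi> * (\<gamma> * \<eta> * \<delta> - \<alpha>)) \<triangleright> v"
    "\<x> \<triangleright> \<x> \<triangleright> v = fconst (1 - \<gamma> ^ 2) \<triangleright> v"
proof -
  have v: "v \<in> carrier M" "\<b> \<triangleright> v = \<zero>" "\<c> \<triangleright> v = \<zero>" "\<g> \<triangleright> v = fconst \<gamma> \<triangleright> v" "\<h> \<triangleright> v = fconst \<eta> \<triangleright> v"
    "\<a> \<triangleright> v = fconst \<alpha> \<triangleright> v" "\<d> \<triangleright> v = fconst \<delta> \<triangleright> v"
    using assms by (auto simp: weight_vector_def)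
  have one: "1 \<triangleright> v = fconst 1 \<triangleright> v" by (simp add: fconst_simps)
  have solve: "y = fconst (- k) \<triangleright> w"
    if "y \<oplus> fconst k \<triangleright> w = \<zero>" "y \<in> carrier M" "w \<in> carrier M" for y k w
    using that by (simp add: act_uminus fconst_simps(5) minus_equality)
  show "\<g> \<triangleright> \<x> \<triangleright> v = fconst \<gamma> \<triangleright> \<x> \<triangleright> v" "\<h> \<triangleright> \<x> \<triangleright> v = fconst (- \<eta>) \<triangleright> \<x> \<triangleright> v"
    using x_act(1,2)[of v] v by (simp_all add: act_normalize)
  show "\<a> \<triangleright> \<x> \<triangleright> v = fconst (\<alpha> / \<xi>) \<triangleright> \<x> \<triangleright> v" "\<d> \<triangleright> \<x> \<triangleright> v = fconst (- \<delta> / \<xi>) \<triangleright> \<x> \<triangleright> v"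
    using x_K24_act(1,2)[of v] v solve[of "\<a> \<triangleright> \<x> \<triangleright> v" "- (\<alpha> * inverse \<xi>)" "\<x> \<triangleright> v"]
      solve[of "\<d> \<triangleright> \<x> \<triangleright> v" "\<delta> * inverse \<xi>" "\<x> \<triangleright> v"]
    by (simp_all add: act_normalize divide_inverse mult.commute)
  show "\<b> \<triangleright> \<x> \<triangleright> v = fconst (- s / \<xi> * (\<delta> - \<gamma> * \<eta> * \<alpha>)) \<triangleright> v"
    "\<c> \<triangleright> \<x> \<triangleright> v = fconst (- s / \<xi> * (\<gamma> * \<eta> * \<delta> - \<alpha>)) \<triangleright> v"
    using x_K24_act(3,4)[of v] v by (simp_all add: act_normalize divide_inverse algebra_simps)
  show "\<x> \<triangleright> \<x> \<triangleright> v = fconst (1 - \<gamma> ^ 2) \<triangleright> v"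
    using x_act(3)[of v] v one
    by (simp add: act_normalize power2_eq_square del: act_1)
qed

text \<open>
  If \<open>x\<close> kills \<open>v\<close>, then the equations for \<open>b x v\<close> and \<open>x x v\<close> say that \<open>\<delta> = \<gamma> \<eta> \<alpha>\<close> and
  \<open>\<gamma> ^ 2 = 1\<close>, so the generators act on the line of \<open>v\<close> through one of the characters.
\<close>

lemma iso_k_chi:
  assumes simple: "simple_left_module (presented_algebra \<D>) M"
    and v: "weight_vector \<gamma> \<eta> \<alpha> \<delta> v" and xv: "\<x> \<triangleright> v = \<zero>"
  shows "\<exists>(i, j, k)\<in>chi_index. module_iso (presented_algebra \<D>) M (k_chi \<xi> i j k)"
proof -
  note rel = weight_relations[OF v]
  have vC: "v \<in> carrier M" "v \<noteq> \<zero>" using v by (auto simp: weight_vector_def)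
  have v0: "fconst 0 \<triangleright> v = \<zero>" using vC by (simp add: fconst_simps)
  have "fconst (- s / \<xi> * (\<delta> - \<gamma> * \<eta> * \<alpha>)) \<triangleright> v = fconst 0 \<triangleright> v"
    using x_weight_vector(5)[OF v] xv v0 by simp
  then have \<delta>: "\<delta> = \<gamma> * \<eta> * \<alpha>"
    using act_fconst_cancel[OF vC, of "- s / \<xi> * (\<delta> - \<gamma> * \<eta> * \<alpha>)" 0] by simp
  have "fconst (1 - \<gamma> ^ 2) \<triangleright> v = fconst 0 \<triangleright> v"
    using x_weight_vector(7)[OF v] xv v0 by simp
  then have "\<gamma> ^ 2 = 1"
    using act_fconst_cancel[OF vC, of "1 - \<gamma> ^ 2" 0] by simp
  then obtain i where i: "i \<in> {0, 1}" "\<gamma> = (- 1) ^ i" by (rule sign_cases)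
  obtain j where j: "j \<in> {0, 1}" "\<eta> = (- 1) ^ j" using rel(2) by (rule sign_cases)
  obtain k where k: "k \<in> {0..5}" "\<alpha> = \<xi> ^ k" using rel(3) by (rule sixth_root_cases)
  define \<phi> :: "'k^1 \<Rightarrow> 'm" where "\<phi> u = fconst (u$1) \<triangleright> v" for u
  have act: "fgen y \<triangleright> v = fconst (chi \<xi> i j k y) \<triangleright> v" for y
    using v xv v0 \<delta> by (cases y) (simp_all add: weight_vector_def i j k)
  have "module_hom (presented_algebra \<D>) (k_chi \<xi> i j k) M \<phi>"
    unfolding k_chi_def
    by (rule module_hom_matrix_module[OF chi_satisfies])
       (simp_all add: \<phi>_def vC act_fconst_add act_fconst_fconst act_gen_fconst act mat_mult_vec mult.commute)
  moreover have "\<phi> (vec 1) \<noteq> \<zero>" using vC by (simp add: \<phi>_def fconst_simps)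
  ultimately have "module_iso (presented_algebra \<D>) (k_chi \<xi> i j k) M"
    using Schur[OF simple_k_chi[unfolded double_eq] simple, of i j k \<phi> "vec 1"]
    by (simp add: k_chi_def)
  then have "module_iso (presented_algebra \<D>) M (k_chi \<xi> i j k)"
    using module_iso_sym simple_left_moduleD(1)[OF simple_k_chi[unfolded double_eq]] by blast
  then show ?thesis using i(1) j(1) k(1) unfolding chi_index_def by blast
qed

text \<open>
  The condition says that \<open>c x v = \<kappa> v\<close> with \<open>\<kappa> \<noteq> 0\<close>. In \<open>V\<close> the vector \<open>v2\<close> satisfies \<open>c v2 = v1\<close>,
  which forces \<open>v1 \<mapsto> v\<close> and \<open>v2 \<mapsto> x v / \<kappa>\<close>.
\<close>

lemma iso_V_module:
  assumes simple: "simple_left_module (presented_algebra \<D>) M"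
    and v: "weight_vector \<gamma> \<eta> \<alpha> \<delta> v" and ne: "\<gamma> * \<eta> * \<delta> \<noteq> \<alpha>"
  shows "\<exists>(i, j, k, \<iota>)\<in>Lambda. module_iso (presented_algebra \<D>) M (V_module \<xi> s i j k \<iota>)"
proof -
  note rel = weight_relations[OF v]
  have vC: "v \<in> carrier M" "v \<noteq> \<zero>" using v by (auto simp: weight_vector_def)
  obtain i where i: "i \<in> {0..5}" "\<delta> = \<xi> ^ i" using rel(4) by (rule sixth_root_cases)
  obtain j where j: "j \<in> {0..5}" "\<gamma> = \<xi> ^ j" using rel(1) by (rule sixth_root_cases)
  obtain k where k: "k \<in> {0, 1}" "\<eta> = (- 1) ^ k" using rel(2) by (rule sign_cases)
  have "(- \<alpha> / \<delta>) ^ 2 = 1" using rel(5) i(2) by (simp add: power_divide)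
  then obtain \<iota> where \<iota>: "\<iota> \<in> {0, 1}" "- \<alpha> / \<delta> = (- 1) ^ \<iota>" by (rule sign_cases)
  define e :: 'k where "e = (- 1) ^ \<iota>"
  have e: "e * e = 1" by (simp add: e_def flip: power_mult_distrib)
  have "e * \<delta> = - \<alpha>" using \<iota>(2) i(2) by (simp add: e_def field_simps)
  then have \<alpha>: "\<alpha> = - e * \<delta>" by simp
  have \<delta>0: "\<delta> \<noteq> 0" using i(2) by simp
  define \<kappa> where "\<kappa> = kappa i j k \<iota>"
  have \<kappa>: "\<kappa> = - s / \<xi> * (\<gamma> * \<eta> * \<delta> - \<alpha>)"
    unfolding \<kappa>_def kappa_def \<alpha>
    by (simp add: i(2)[symmetric] j(2)[symmetric] k(2)[symmetric] e_def[symmetric] divide_inverse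
        algebra_simps)
  then have \<kappa>0: "\<kappa> \<noteq> 0" using ne by simp
  have idx: "(i, j, k, \<iota>) \<in> Lambda"
    using \<kappa>0 i(1) j(1) k(1) \<iota>(1) kappa_nonzero_iff[of i j k \<iota>] by (simp add: Lambda_def \<kappa>_def)
  define \<phi> :: "'k^2 \<Rightarrow> 'm"
    where "\<phi> u = fconst (u$1) \<triangleright> v \<oplus> fconst (u$2 / \<kappa>) \<triangleright> \<x> \<triangleright> v" for u
  have add: "\<phi> (u + u') = \<phi> u \<oplus> \<phi> u'" for u u'
    using vC by (simp add: \<phi>_def act_fconst_add[symmetric] add_divide_distrib a_ac)
  have scal: "\<phi> (c *s u) = fconst c \<triangleright> \<phi> u" for c u
    using vC by (simp add: \<phi>_def act_add act_fconst_fconst)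
  have gen: "\<phi> (V_matrix \<xi> s i j k \<iota> y *v u) = fgen y \<triangleright> \<phi> u" for y u
  proof -
    have lin: "fgen y \<triangleright> \<phi> u = fconst (u$1) \<triangleright> fgen y \<triangleright> v \<oplus> fconst (u$2 / \<kappa>) \<triangleright> fgen y \<triangleright> \<x> \<triangleright> v" for y
      using vC by (simp add: \<phi>_def act_add act_gen_fconst)
    have z: "fconst 0 \<triangleright> x = \<zero>" if "x \<in> carrier M" for x
      using that by (simp add: fconst_simps)
    \<comment> \<open>Compatibility of \<open>\<phi>\<close> with \<open>b\<close> and with the two entries of \<open>x\<close>, as identities of scalars.\<close>
    have b: "- s / \<xi> * (\<delta> - \<gamma> * \<eta> * \<alpha>) = e * \<kappa>"
      unfolding \<kappa> \<alpha> using e by (simp add: divide_simps) Groebner_Basis.algebra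
    have x: "1 - \<gamma> ^ 2 = inverse s * (\<xi> / \<delta>) * (\<gamma> * \<eta> - e) * \<kappa>"
      unfolding \<kappa> \<alpha> using e rel(2) \<delta>0 by (simp add: divide_simps) Groebner_Basis.algebra
    have x': "- s * (\<delta> / \<xi>) * (\<gamma> * \<eta> + e) = \<kappa>"
      unfolding \<kappa> \<alpha> by (simp add: algebra_simps add_divide_distrib)
    have bx: "\<b> \<triangleright> \<x> \<triangleright> v = fconst (e * \<kappa>) \<triangleright> v" and cx: "\<c> \<triangleright> \<x> \<triangleright> v = fconst \<kappa> \<triangleright> v"
      using x_weight_vector(5)[OF v, unfolded b] x_weight_vector(6)[OF v, folded \<kappa>] by simp_all
    show ?thesis
    proof (cases y)
      case Gen_x
      then show ?thesis
      proof -
        let ?w = "V_matrix \<xi> s i j k \<iota> Gen_x *v u"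
        have "?w $ 1 = u$2 / \<kappa> * (1 - \<gamma> ^ 2)" "?w $ 2 / \<kappa> = u$1"
          using \<kappa>0 unfolding x x'[symmetric]
          by (simp_all add: mat22_mult_vec power_powi e_def i(2) j(2) k(2))
        then show ?thesis
          unfolding lin unfolding Gen_x x_weight_vector(7)[OF v]
          using vC by (simp add: \<phi>_def act_fconst_fconst a_comm)
      qed
    qed (use v vC in \<open>simp_all add: lin x_weight_vector(1-4)[OF v] bx cx\<close>, use v vC in \<open>simp_all add: weight_vector_def \<phi>_def mat22_mult_vec power_powi z act_fconst_fconst \<alpha> e_def \<kappa>0 i(2) j(2) k(2) mult.commute\<close>)
  qed
  have closed: "\<phi> u \<in> carrier M" for u using vC by (simp add: \<phi>_def)
  have "module_hom (presented_algebra \<D>) (V_module \<xi> s i j k \<iota>) M \<phi>"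
    unfolding V_module_def by (rule module_hom_matrix_module[OF V_matrix_satisfies closed add scal gen])
  moreover have "\<phi> (vector [1, 0]) \<noteq> \<zero>" using vC by (simp add: \<phi>_def fconst_simps)
  moreover have sV: "simple_left_module (presented_algebra \<D>) (V_module \<xi> s i j k \<iota>)"
    using simple_V_module[unfolded double_eq] \<kappa>0 by (simp add: \<kappa>_def)
  ultimately have "module_iso (presented_algebra \<D>) (V_module \<xi> s i j k \<iota>) M"
    using Schur[OF sV simple, of \<phi> "vector [1, 0]"] by (simp add: V_module_def)
  then have "module_iso (presented_algebra \<D>) M (V_module \<xi> s i j k \<iota>)"
    using module_iso_sym simple_left_moduleD(1)[OF sV] by blast
  then show ?thesis using idx by blast
qed

text \<open>
  If \<open>\<gamma> \<eta> \<delta> = \<alpha>\<close>, then \<open>\<alpha> ^ 2 = \<delta> ^ 2\<close> gives \<open>\<gamma> ^ 2 = 1\<close>, and \<open>b\<close>, \<open>c\<close>, \<open>x\<close> all kill \<open>x v\<close>. So \<open>x v\<close> is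
  a weight vector killed by \<open>x\<close>, unless it is zero, and then \<open>v\<close> is one.
\<close>

theorem classification:
  assumes simple: "simple_left_module (presented_algebra \<D>) M"
  shows "(\<exists>(i, j, k)\<in>chi_index. module_iso (presented_algebra \<D>) M (k_chi \<xi> i j k)) \<or>
    (\<exists>(i, j, k, \<iota>)\<in>Lambda. module_iso (presented_algebra \<D>) M (V_module \<xi> s i j k \<iota>))"
proof -
  obtain \<gamma> \<eta> \<alpha> \<delta> v where v: "weight_vector \<gamma> \<eta> \<alpha> \<delta> v"
    using weight_vector_exists simple_left_moduleD(2)[OF simple] by blast
  show ?thesis
  proof (cases "\<gamma> * \<eta> * \<delta> = \<alpha>")
    case False
    then show ?thesis using iso_V_module[OF simple v] by blast
  next
    case True
    note rel = weight_relations[OF v]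
    have vC: "v \<in> carrier M" using v by (auto simp: weight_vector_def)
    have \<delta>0: "\<delta> \<noteq> 0" using rel(4) by auto
    have "\<gamma> ^ 2 * \<delta> ^ 2 = \<delta> ^ 2" using rel(2,5) True[symmetric] by (simp add: power_mult_distrib)
    then have \<gamma>2: "\<gamma> ^ 2 = 1" using \<delta>0 by simp
    have \<delta>: "\<delta> = \<gamma> * \<eta> * \<alpha>"
      using rel(2) \<gamma>2 unfolding True[symmetric] by (simp add: power2_eq_square algebra_simps)
    show ?thesis
    proof (cases "\<x> \<triangleright> v = \<zero>")
      case x0: True
      then show ?thesis using iso_k_chi[OF simple v] by blast
    next
      case False
      have z: "fconst 0 \<triangleright> v = \<zero>" using vC by (simp add: fconst_simps)
      have "\<gamma> * \<eta> * \<delta> - \<alpha> = 0" "\<delta> - \<gamma> * \<eta> * \<alpha> = 0" using True \<delta> by simp_all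
      then have "\<b> \<triangleright> \<x> \<triangleright> v = \<zero>" "\<c> \<triangleright> \<x> \<triangleright> v = \<zero>"
        using x_weight_vector(5,6)[OF v] by (simp_all only: mult_zero_right z)
      then have "weight_vector \<gamma> (- \<eta>) (\<alpha> / \<xi>) (- \<delta> / \<xi>) (\<x> \<triangleright> v)"
        using x_weight_vector(1-4)[OF v] vC False by (simp add: weight_vector_def)
      moreover have "\<x> \<triangleright> \<x> \<triangleright> v = \<zero>" using x_weight_vector(7)[OF v] \<gamma>2 z by simp
      ultimately show ?thesis using iso_k_chi[OF simple] by blast
    qed
  qed
qed

end

section \<open>Counting\<close>

lemma card_chi_index: "card chi_index = 24"
  by (simp add: chi_index_def card_cartesian_product)

text \<open>
  The index \<open>i\<close> is free. For each of the four choices of \<open>k\<close> and \<open>\<iota>\<close> exactly one of the six values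
  of \<open>j\<close> is excluded.
\<close>

lemma card_Lambda: "card Lambda = 120"
proof -
  define A :: "(nat \<times> nat \<times> nat) set" where "A = {0..5} \<times> {0, 1} \<times> {0, 1}"
  define B :: "(nat \<times> nat \<times> nat) set" where "B = {(3, 0, 0), (0, 0, 1), (0, 1, 0), (3, 1, 1)}"
  have mem: "[j + 3 * k = 3 * (\<iota> + 1)] (mod 6) \<longleftrightarrow> (j, k, \<iota>) \<in> B" if "(j, k, \<iota>) \<in> A" for j k \<iota>
  proof -
    have "j < 6" "k = 0 \<or> k = 1" "\<iota> = 0 \<or> \<iota> = 1" using that by (auto simp: A_def)
    then show ?thesis
      by (elim disjE; simp add: B_def cong_def; presburger?)
  qed
  have "Lambda = {0..5} \<times> {(j, k, \<iota>) \<in> A. \<not> [j + 3 * k = 3 * (\<iota> + 1)] (mod 6)}"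
    by (auto simp: Lambda_def A_def)
  moreover have "{(j, k, \<iota>) \<in> A. \<not> [j + 3 * k = 3 * (\<iota> + 1)] (mod 6)} = A - B"
    using mem by auto
  ultimately have L: "Lambda = {0..5} \<times> (A - B)" by simp
  have "card Lambda = card {0..5::nat} * card (A - B)"
    unfolding L by (rule card_cartesian_product)
  moreover have "card (A - B) = card A - card B"
    by (rule card_Diff_subset) (simp_all add: A_def B_def)
  moreover have "card A = 24" "card B = 4"
    by (simp_all add: A_def B_def card_cartesian_product)
  ultimately show ?thesis by simp
qed

lemma card_simple_classes:
  fixes T :: "'l \<Rightarrow> ('a, 'm) module"
  assumes simple: "\<And>l. l \<in> L \<Longrightarrow> simple_left_module R (T l)"
    and distinct: "\<And>l l'. l \<in> L \<Longrightarrow> l' \<in> L \<Longrightarrow> module_iso R (T l) (T l') \<Longrightarrow> l = l'"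
    and complete: "\<And>M :: ('a, 'm) module. simple_left_module R M \<Longrightarrow> \<exists>l\<in>L. module_iso R M (T l)"
  shows "card (simple_classes R :: ('a, 'm) module set set) = card L"
proof -
  define r :: "('a, 'm) module rel" where
    "r = {(M, N). simple_left_module R M \<and> simple_left_module R N \<and> module_iso R M N}"
  have classes: "simple_classes R = {M. simple_left_module R M} // r"
    by (simp add: simple_classes_def r_def)
  have eq: "r `` {M} = r `` {N}"
    if "simple_left_module R M" "simple_left_module R N" "module_iso R M N" for M N
    using that module_iso_trans module_iso_sym[OF simple_left_moduleD(1)[OF that(1)] that(3)]
    by (auto simp: r_def intro: module_iso_trans)
  have "bij_betw (\<lambda>l. r `` {T l}) L (simple_classes R)"
  proof (rule bij_betwI')
    fix l l' assume l: "l \<in> L" "l' \<in> L"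
    have "T l' \<in> r `` {T l'}" using simple[OF l(2)] module_iso_refl by (auto simp: r_def)
    then show "(r `` {T l} = r `` {T l'}) = (l = l')"
      using distinct[OF l] by (auto simp: r_def)
  next
    fix l assume "l \<in> L"
    then show "r `` {T l} \<in> simple_classes R" using simple by (auto simp: classes quotient_def)
  next
    fix C assume "C \<in> (simple_classes R :: ('a, 'm) module set set)"
    then obtain M where M: "simple_left_module R M" "C = r `` {M}"
      by (auto simp: classes quotient_def)
    obtain l where "l \<in> L" "module_iso R M (T l)" using complete[OF M(1)] by blast
    then show "\<exists>l\<in>L. C = r `` {T l}" using eq[OF M(1) simple] M(2) by blast
  qed
  then show ?thesis by (rule bij_betw_same_card[symmetric])
qed

lemma transport_simple_module:
  fixes M :: "('a, 'm) module" and e :: "'m \<Rightarrow> 'n"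
  assumes "simple_left_module R M" "inj e"
  shows "\<exists>N :: ('a, 'n) module. simple_left_module R N \<and> module_iso R M N"
  using transport_left_module[OF simple_left_moduleD(1)[OF assms(1)], of e]
    simple_left_module_iso[OF assms(1)] inj_on_subset[OF assms(2)] by blast

theorem theorem3p8:
  fixes \<xi> s :: "'k::{alg_closed_field, field_char_0}"
  assumes "primitive_root_of_unity 6 \<xi>"
    and "s ^ 2 = 1 - \<xi> ^ 2"
  shows
    "card chi_index = 24 \<and> card Lambda = 120 \<and>
     (\<forall>(i, j, k) \<in> chi_index. simple_left_module (double \<xi> s) (k_chi \<xi> i j k)) \<and>
     (\<forall>(i, j, k, \<iota>) \<in> Lambda. simple_left_module (double \<xi> s) (V_module \<xi> s i j k \<iota>)) \<and>
     (\<forall>(i, j, k) \<in> chi_index. \<forall>(i', j', k') \<in> chi_index.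
        module_iso (double \<xi> s) (k_chi \<xi> i j k) (k_chi \<xi> i' j' k') \<longrightarrow>
        (i, j, k) = (i', j', k')) \<and>
     (\<forall>(i, j, k, \<iota>) \<in> Lambda. \<forall>(i', j', k', \<iota>') \<in> Lambda.
        module_iso (double \<xi> s) (V_module \<xi> s i j k \<iota>) (V_module \<xi> s i' j' k' \<iota>') \<longrightarrow>
        (i, j, k, \<iota>) = (i', j', k', \<iota>')) \<and>
     (\<forall>(i, j, k) \<in> chi_index. \<forall>(i', j', k', \<iota>') \<in> Lambda.
        \<not> module_iso (double \<xi> s) (k_chi \<xi> i j k) (V_module \<xi> s i' j' k' \<iota>')) \<and>
     (\<forall>M :: ('k double_elem, 'm) module. simple_left_module (double \<xi> s) M \<longrightarrow>
        (\<exists>(i, j, k) \<in> chi_index. module_iso (double \<xi> s) M (k_chi \<xi> i j k)) \<or>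
        (\<exists>(i, j, k, \<iota>) \<in> Lambda. module_iso (double \<xi> s) M (V_module \<xi> s i j k \<iota>))) \<and>
     ((\<exists>e :: 'k^2 \<Rightarrow> 'm. inj e) \<longrightarrow>
        card (simple_classes (double \<xi> s) :: ('k double_elem, 'm) module set set) = 144)"
proof -
  interpret double_data \<xi> s by unfold_locales (fact assms)+
  let ?D = "double \<xi> s"
  let ?L = "Sum_Type.Plus chi_index Lambda"
  have simple_V: "simple_left_module ?D (V_module \<xi> s i j k \<iota>)" if "(i, j, k, \<iota>) \<in> Lambda" for i j k \<iota>
    using that by (intro simple_V_module) (simp add: kappa_nonzero_iff Lambda_def)
  have complete: "(\<exists>(i, j, k) \<in> chi_index. module_iso ?D M (k_chi \<xi> i j k)) \<or>
      (\<exists>(i, j, k, \<iota>) \<in> Lambda. module_iso ?D M (V_module \<xi> s i j k \<iota>))"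
    if M: "simple_left_module ?D M" for M :: "('k double_elem, 'm) module"
  proof -
    interpret double_module \<xi> s M
      by unfold_locales (use simple_left_moduleD(1)[OF M] in \<open>simp add: double_eq\<close>)
    show ?thesis using classification M by (simp add: double_eq)
  qed
  have count: "card (simple_classes ?D :: ('k double_elem, 'm) module set set) = 144"
    if e: "inj e" for e :: "'k^2 \<Rightarrow> 'm"
  proof -
    \<comment> \<open>The line embeds into the plane, so the given injection serves both families.\<close>
    define e' :: "'k^1 \<Rightarrow> 'm" where "e' u = e (vector [u$1, 0])" for u
    have e': "inj e'"
    proof (rule injI)
      fix u u' assume "e' u = e' u'"
      then have "vector [u$1, 0] = (vector [u'$1, 0] :: 'k^2)" using injD[OF e] by (simp add: e'_def)
      from arg_cong[OF this, of "\<lambda>w :: 'k^2. w$1"] show "u = u'" by (simp add: vec_eq_iff forall_1)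
    qed
    have "\<forall>l\<in>chi_index. \<exists>N :: ('k double_elem, 'm) module.
        simple_left_module ?D N \<and> (case l of (i, j, k) \<Rightarrow> module_iso ?D (k_chi \<xi> i j k) N)"
      using transport_simple_module[OF simple_k_chi e'] by auto
    then obtain T1 :: "_ \<Rightarrow> ('k double_elem, 'm) module" where T1:
      "\<And>i j k. (i, j, k) \<in> chi_index \<Longrightarrow> simple_left_module ?D (T1 (i, j, k))"
      "\<And>i j k. (i, j, k) \<in> chi_index \<Longrightarrow> module_iso ?D (k_chi \<xi> i j k) (T1 (i, j, k))"
      by (metis (no_types, lifting) case_prod_conv)
    have "\<forall>l\<in>Lambda. \<exists>N :: ('k double_elem, 'm) module.
        simple_left_module ?D N \<and> (case l of (i, j, k, \<iota>) \<Rightarrow> module_iso ?D (V_module \<xi> s i j k \<iota>) N)"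
      using transport_simple_module[OF simple_V e] by auto
    then obtain T2 :: "_ \<Rightarrow> ('k double_elem, 'm) module" where T2:
      "\<And>i j k \<iota>. (i, j, k, \<iota>) \<in> Lambda \<Longrightarrow> simple_left_module ?D (T2 (i, j, k, \<iota>))"
      "\<And>i j k \<iota>. (i, j, k, \<iota>) \<in> Lambda \<Longrightarrow> module_iso ?D (V_module \<xi> s i j k \<iota>) (T2 (i, j, k, \<iota>))"
      by (metis (no_types, lifting) case_prod_conv)
    note back1 = module_iso_sym[OF simple_left_moduleD(1)[OF simple_k_chi] T1(2)]
    note back2 = module_iso_sym[OF simple_left_moduleD(1)[OF simple_V] T2(2)]
    have "card (simple_classes ?D :: ('k double_elem, 'm) module set set) = card ?L"
    proof (rule card_simple_classes[where T = "case_sum T1 T2"])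
      fix l assume "l \<in> ?L"
      then show "simple_left_module ?D (case_sum T1 T2 l)" using T1(1) T2(1) by auto
    next
      have 11: "l = l'" if l: "l \<in> chi_index" "l' \<in> chi_index" "module_iso ?D (T1 l) (T1 l')" for l l'
      proof -
        obtain i j k i' j' k' where eqs: "l = (i, j, k)" "l' = (i', j', k')" by (metis prod_cases3)
        have "module_iso ?D (k_chi \<xi> i j k) (k_chi \<xi> i' j' k')"
          using module_iso_trans[OF T1(2) module_iso_trans[OF l(3)[unfolded eqs] back1]] l eqs by simp
        then show ?thesis using k_chi_iso_eq l eqs by simp
      qed
      have 22: "l = l'" if l: "l \<in> Lambda" "l' \<in> Lambda" "module_iso ?D (T2 l) (T2 l')" for l l'
      proof -
        obtain i j k \<iota> i' j' k' \<iota>' where eqs: "l = (i, j, k, \<iota>)" "l' = (i', j', k', \<iota>')"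
          by (metis prod_cases4)
        have "module_iso ?D (V_module \<xi> s i j k \<iota>) (V_module \<xi> s i' j' k' \<iota>')"
          using module_iso_trans[OF T2(2) module_iso_trans[OF l(3)[unfolded eqs] back2]] l eqs by simp
        then show ?thesis using V_module_iso_eq l eqs by simp
      qed
      have 12: "\<not> module_iso ?D (T1 l) (T2 l')" if l: "l \<in> chi_index" "l' \<in> Lambda" for l l'
      proof
        assume iso: "module_iso ?D (T1 l) (T2 l')"
        obtain i j k i' j' k' \<iota>' where eqs: "l = (i, j, k)" "l' = (i', j', k', \<iota>')"
          by (metis prod_cases3 prod_cases4)
        have "module_iso ?D (k_chi \<xi> i j k) (V_module \<xi> s i' j' k' \<iota>')"
          using module_iso_trans[OF T1(2) module_iso_trans[OF iso[unfolded eqs] back2]] l eqs by simp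
        then show False using k_chi_not_iso_V by blast
      qed
      have 21: "\<not> module_iso ?D (T2 l') (T1 l)" if "l \<in> chi_index" "l' \<in> Lambda" for l l'
        using 12[OF that] module_iso_sym[OF simple_left_moduleD(1)] T2(1) that by (cases l') blast
      fix l l' assume "l \<in> ?L" "l' \<in> ?L" "module_iso ?D (case_sum T1 T2 l) (case_sum T1 T2 l')"
      then show "l = l'" using 11 22 12 21 by (auto elim!: PlusE)
    next
      fix M :: "('k double_elem, 'm) module" assume "simple_left_module ?D M"
      from complete[OF this] show "\<exists>l\<in>?L. module_iso ?D M (case_sum T1 T2 l)"
      proof
        assume "\<exists>(i, j, k) \<in> chi_index. module_iso ?D M (k_chi \<xi> i j k)"
        then obtain i j k where "(i, j, k) \<in> chi_index" "module_iso ?D M (k_chi \<xi> i j k)" by auto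
        then show ?thesis
          using module_iso_trans[OF _ T1(2)] by (intro bexI[of _ "Inl (i, j, k)"]) (auto intro!: InlI)
      next
        assume "\<exists>(i, j, k, \<iota>) \<in> Lambda. module_iso ?D M (V_module \<xi> s i j k \<iota>)"
        then obtain i j k \<iota> where "(i, j, k, \<iota>) \<in> Lambda" "module_iso ?D M (V_module \<xi> s i j k \<iota>)" by auto
        then show ?thesis
          using module_iso_trans[OF _ T2(2)] by (intro bexI[of _ "Inr (i, j, k, \<iota>)"]) (auto intro!: InrI)
      qed
    qed
    also have "card ?L = 144"
      using card_chi_index card_Lambda by (simp add: card_Plus card_ge_0_finite)
    finally show ?thesis .
  qed
  show ?thesis
  proof (intro conjI)
    show "\<forall>(i, j, k) \<in> chi_index. simple_left_module ?D (k_chi \<xi> i j k)"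
      by (auto intro: simple_k_chi)
    show "\<forall>(i, j, k, \<iota>) \<in> Lambda. simple_left_module ?D (V_module \<xi> s i j k \<iota>)"
      by (auto intro: simple_V)
    show "\<forall>(i, j, k) \<in> chi_index. \<forall>(i', j', k') \<in> chi_index.
        module_iso ?D (k_chi \<xi> i j k) (k_chi \<xi> i' j' k') \<longrightarrow> (i, j, k) = (i', j', k')"
      by (clarify, drule k_chi_iso_eq, assumption+, blast)
    show "\<forall>(i, j, k, \<iota>) \<in> Lambda. \<forall>(i', j', k', \<iota>') \<in> Lambda.
        module_iso ?D (V_module \<xi> s i j k \<iota>) (V_module \<xi> s i' j' k' \<iota>') \<longrightarrow>
        (i, j, k, \<iota>) = (i', j', k', \<iota>')"
      by (clarify, drule V_module_iso_eq, assumption+, blast)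
    show "\<forall>(i, j, k) \<in> chi_index. \<forall>(i', j', k', \<iota>') \<in> Lambda.
        \<not> module_iso ?D (k_chi \<xi> i j k) (V_module \<xi> s i' j' k' \<iota>')"
      using k_chi_not_iso_V by blast
  qed (use card_chi_index card_Lambda complete count in blast)+
qed

end
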